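(* Let $\Sigma$ be a germ at $0$ of a closed subset of $\mathbb{R}^n$ with $0\in\Sigma$, let $r$ be a positive integer, $n\ge p$, and $f\in\mathcal{E}_{[r]}(n,p)$. If $f$ satisfies condition $(\widetilde K_\Sigma)$, i.e. $d(x,\Sigma)\kappa(df(x))+\|f(x)\|\succsim d(x,\Sigma)^r$ in some neighbourhood of $0$, then $j^rf(\Sigma;0)$ is $\Sigma$-$V$-sufficient in $\mathcal{E}_{[r]}(n,p)$.
   Context: $\mathcal{E}_{[s]}(n,p)$ is the set of germs at $0$ of $C^s$ maps $(\mathbb{R}^n,0)\to(\mathbb{R}^p,0)$. $j^rf(\Sigma;0)=j^rg(\Sigma;0)$ means the $r$-jets of $f,g$ coincide at every point of $\Sigma\cap U$ for some neighbourhood $U$ of $0$. Two germs $f,g$ are $\Sigma$-$V$-equivalent if the germs at $0$ of $f^{-1}(0)$ and $g^{-1}(0)$ are homeomorphic by a homeomorphism fixing $f^{-1}(0)\cap\Sigma$ pointwise; the relative jet $w$ is $\Sigma$-$V$-sufficient in $\mathcal{E}_{[s]}(n,p)$ if any two realisations $g,h\in\mathcal{E}_{[s]}(n,p)$ of $w$ are $\Sigma$-$V$-equivalent. $d(x,\Sigma)$ is the distance to $\Sigma$; $\phi\precsim\psi$ means $\phi\le K\psi$ on some closed ball about $0$. $\kappa(df(x))=\min_i\operatorname{dist}(\operatorname{grad}f_i(x),\operatorname{span}\{\operatorname{grad}f_j(x):j\ne i\})$. *)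

theory Defs
  imports "HOL-Analysis.Analysis"
begin

primrec hpd :: "'n list \<Rightarrow> (real^'n \<Rightarrow> real) \<Rightarrow> real^'n \<Rightarrow> real" where
  "hpd [] g = g"
| "hpd (i # is) g = (\<lambda>x. deriv (\<lambda>t. hpd is g (x + t *\<^sub>R axis i 1)) 0)"

definition Ck :: "nat \<Rightarrow> (real^'n) set \<Rightarrow> (real^'n \<Rightarrow> real) \<Rightarrow> bool" where
  "Ck k U g \<longleftrightarrow> (\<forall>is::'n list. length is \<le> k \<longrightarrow>
      continuous_on U (hpd is g) \<and>
      (length is < k \<longrightarrow> (\<forall>i. \<forall>x\<in>U. \<exists>D.
          ((\<lambda>t. hpd is g (x + t *\<^sub>R axis i 1)) has_real_derivative D) (at 0))))"

definition germ_Cr :: "nat \<Rightarrow> (real^'n \<Rightarrow> real^'p) \<Rightarrow> bool" where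
  "germ_Cr r f \<longleftrightarrow> f 0 = 0 \<and>
     (\<exists>U. open U \<and> 0 \<in> U \<and> (\<forall>j. Ck r U (\<lambda>x. f x $ j)))"

definition rel_jet_eq :: "nat \<Rightarrow> (real^'n) set \<Rightarrow> (real^'n \<Rightarrow> real^'p) \<Rightarrow> (real^'n \<Rightarrow> real^'p) \<Rightarrow> bool" where
  "rel_jet_eq r S f g \<longleftrightarrow> (\<exists>U. open U \<and> 0 \<in> U \<and>
     (\<forall>x\<in>S \<inter> U. \<forall>is::'n list. length is \<le> r \<longrightarrow>
        (\<forall>j. hpd is (\<lambda>y. f y $ j) x = hpd is (\<lambda>y. g y $ j) x)))"

definition SV_equiv :: "(real^'n) set \<Rightarrow> (real^'n \<Rightarrow> real^'p) \<Rightarrow> (real^'n \<Rightarrow> real^'p) \<Rightarrow> bool" where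
  "SV_equiv S f g \<longleftrightarrow> (\<exists>U V \<phi> \<psi>. open U \<and> open V \<and> 0 \<in> U \<and> 0 \<in> V \<and>
     homeomorphism {x\<in>U. f x = 0} {x\<in>V. g x = 0} \<phi> \<psi> \<and>
     (\<forall>x\<in>{x\<in>U. f x = 0} \<inter> S. \<phi> x = x))"

definition SV_sufficient :: "nat \<Rightarrow> (real^'n) set \<Rightarrow> (real^'n \<Rightarrow> real^'p) \<Rightarrow> bool" where
  "SV_sufficient r S f \<longleftrightarrow> (\<forall>g h. germ_Cr r g \<and> germ_Cr r h \<and>
      rel_jet_eq r S g f \<and> rel_jet_eq r S h f \<longrightarrow> SV_equiv S g h)"

definition grad :: "(real^'n \<Rightarrow> real) \<Rightarrow> real^'n \<Rightarrow> real^'n" where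
  "grad g x = (\<chi> k. hpd [k] g x)"

definition kappa :: "(real^'n \<Rightarrow> real^'p) \<Rightarrow> real^'n \<Rightarrow> real" where
  "kappa f x = Min (range (\<lambda>i. infdist (grad (\<lambda>y. f y $ i) x)
       (span ((\<lambda>j. grad (\<lambda>y. f y $ j) x) ` (UNIV - {i})))))"

end

theory Submission
  imports Defs
begin

text \<open>
  Let g and h be two realisations, F = (1 - t) g + t h, and let d be the distance to S. Near 0 all
  F are flat perturbations of f: they differ from f by a small multiple of d^r, and their
  differentials by a small multiple of d^(r - 1). Hence the condition on f passes to F uniformly in t.

  For r at least 2, let A be the differential of F in x and put M = d^2 A A^T + |F|^2 I. The condition
  says that M is bounded below by a multiple of d^(2 r), so the vector field X = - d^2 A^T w with
  M w = h - g is defined off S; it is locally Lipschitz there and satisfies |X| \<le> d / 4.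
  Along a trajectory the derivative of F is |F|^2 w, so F = 0 is preserved. The term |F|^2 in M is
  what makes X defined off the zero set, so no cut-off to a horn neighbourhood is required. Because of
  |X| \<le> d / 4 the flow extends continuously by the identity on S, and its time-one map is
  the required homeomorphism.

  For r = 1 the vector field is merely continuous, but then either df(0) is onto, and
  g and h are both brought to the linear map df(0) by local homeomorphisms that agree on S, or
  |f| dominates d near 0, so that the zero sets of g and h lie in S, where g = h.
\<close>

section \<open>Partial derivatives and flatness along S\<close>

text \<open>The jets agree along S near 0 and the derivatives of order r are continuous, so the
  constant in front of d^r can be prescribed as small as desired; this smallness is what slows the
  field down. The weights d^2 come from the energy identity w . M w = (d |A^T w|)^2 + (|F| |w|)^2.
  If d |A^T u| + |F| |u| \<ge> m |u| for all u, it yields d |A^T w| \<le> 2 |h - g| / m, whereas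
  inverting M directly would cost m^2. With m a multiple of d^r the powers d^r cancel, and the
  remaining factor d of X gives the bound d / 4. The obstacle is that nothing else is uniform near
  S: w and the Lipschitz constants of X may blow up there. A trajectory, however, keeps at least two
  thirds of its distance to S, so the estimates are made where d \<ge> e, with constants depending
  on e. That suffices for uniqueness off S and, through a bound for w along a single trajectory, for
  preserving F = 0; continuity at points of S comes from the displacement bound alone.\<close>

lemma has_derivative_of_continuous_partials:
  fixes u :: "real^'n \<Rightarrow> real"
  assumes U: "open U" "x \<in> U"
    and D: "\<And>i y. y \<in> U \<Longrightarrow> ((\<lambda>t. u (y + t *\<^sub>R axis i 1)) has_real_derivative D i y) (at 0)"
    and cont: "\<And>i. continuous_on U (D i)"
  shows "(u has_derivative (\<lambda>h. \<Sum>i\<in>UNIV. h $ i * D i x)) (at x)"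
proof -
  have "\<exists>d>0. \<forall>y. norm (y - x) < d \<longrightarrow>
      norm (u y - u x - (\<Sum>i\<in>UNIV. (y - x) $ i * D i x)) \<le> e * norm (y - x)" if "e > 0" for e
  proof -
    define e' where "e' = e / real CARD('n)"
    have "e' > 0" using that by (simp add: e'_def)
    have "\<exists>d>0. ball x d \<subseteq> U \<and> (\<forall>i. \<forall>y\<in>ball x d. \<bar>D i y - D i x\<bar> \<le> e')"
    proof -
      obtain d0 where d0: "d0 > 0" "ball x d0 \<subseteq> U" using U open_contains_ball by blast
      have "\<exists>d>0. \<forall>y\<in>U. dist y x < d \<longrightarrow> dist (D i y) (D i x) < e'" for i
        using cont[of i] U(2) \<open>e' > 0\<close> unfolding continuous_on_iff by blast
      then obtain dd where dd: "\<And>i. dd i > 0"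
        "\<And>i y. y \<in> U \<Longrightarrow> dist y x < dd i \<Longrightarrow> dist (D i y) (D i x) < e'" by metis
      define d where "d = min d0 (Min (range dd))"
      have "d > 0" using d0 dd(1) by (auto simp: d_def)
      moreover have "ball x d \<subseteq> U" using d0(2) by (auto simp: d_def)
      moreover have "\<bar>D i y - D i x\<bar> \<le> e'" if "y \<in> ball x d" for i y
      proof -
        have "d \<le> dd i" by (simp add: d_def min.coboundedI2)
        then show ?thesis
          using dd(2)[of y i] that \<open>ball x d \<subseteq> U\<close> by (auto simp: dist_commute dist_real_def)
      qed
      ultimately show ?thesis by blast
    qed
    then obtain d where d: "d > 0" "ball x d \<subseteq> U" "\<And>i y. y \<in> ball x d \<Longrightarrow> \<bar>D i y - D i x\<bar> \<le> e'"
      by blast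
    \<comment> \<open>Dropping some coordinates of h and shrinking others does not increase the
      norm. Hence every point met while the coordinates are moved one after the other stays in the
      ball around x.\<close>
    have part_norm: "norm (\<Sum>i\<in>I. (c i * h $ i) *\<^sub>R axis i (1::real)) \<le> norm h"
      if "\<And>i. \<bar>c i\<bar> \<le> 1" for I and c :: "'n \<Rightarrow> real" and h :: "real^'n"
    proof (rule norm_le_componentwise_cart)
      fix j
      have "(\<Sum>i\<in>I. (c i * h $ i) *\<^sub>R axis i (1::real)) $ j = (\<Sum>i\<in>I. if i = j then c j * h $ j else 0)"
        unfolding sum_component by (rule sum.cong) (auto simp: axis_def)
      also have "\<dots> = (if j \<in> I then c j * h $ j else 0)" by simp
      finally show "norm ((\<Sum>i\<in>I. (c i * h $ i) *\<^sub>R axis i (1::real)) $ j) \<le> norm (h $ j)"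
        using mult_right_mono[OF that[of j], of "\<bar>h $ j\<bar>"] by (auto simp: abs_mult)
    qed
    \<comment> \<open>The induction runs over the set I of coordinates already moved; adding k costs
      one application of the mean value theorem along the k-th axis.\<close>
    have main: "\<bar>u (x + (\<Sum>i\<in>I. h $ i *\<^sub>R axis i 1)) - u x - (\<Sum>i\<in>I. h $ i * D i x)\<bar>
        \<le> (\<Sum>i\<in>I. e' * \<bar>h $ i\<bar>)" if h: "norm h < d" for h I
    proof (induction I rule: infinite_finite_induct)
      case (insert k I)
      define y where "y = x + (\<Sum>i\<in>I. h $ i *\<^sub>R axis i (1::real))"
      have inb: "y + (\<theta> * h $ k) *\<^sub>R axis k 1 \<in> ball x d" if "\<theta> \<in> {0..1}" for \<theta>
      proof -
        have "y + (\<theta> * h $ k) *\<^sub>R axis k 1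
            = x + (\<Sum>i\<in>insert k I. ((if i = k then \<theta> else 1) * h $ i) *\<^sub>R axis i 1)"
        proof -
          have "(\<Sum>i\<in>I. ((if i = k then \<theta> else 1) * h $ i) *\<^sub>R axis i (1::real)) = (\<Sum>i\<in>I. h $ i *\<^sub>R axis i 1)"
            using insert by (intro sum.cong) auto
          then show ?thesis using insert by (simp add: y_def)
        qed
        moreover have "norm (\<Sum>i\<in>insert k I. ((if i = k then \<theta> else 1) * h $ i) *\<^sub>R axis i (1::real)) \<le> norm h"
          using that by (intro part_norm) auto
        ultimately show ?thesis using h by (simp add: dist_norm norm_minus_commute)
      qed
      have der: "((\<lambda>\<theta>. u (y + (\<theta> * h $ k) *\<^sub>R axis k 1)) has_derivative
          (\<lambda>s. s * (h $ k * D k (y + (\<theta> * h $ k) *\<^sub>R axis k 1)))) (at \<theta> within {0..1})"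
        if "0 \<le> \<theta>" "\<theta> \<le> 1" for \<theta>
      proof -
        let ?z = "y + (\<theta> * h $ k) *\<^sub>R axis k 1"
        \<comment> \<open>The hypothesis on \<open>u\<close> speaks of the parameter value 0.
          Writing 0 as (\<theta> - \<theta>) * h $ k puts it in the shape needed for the chain rule
          at \<theta>.\<close>
        have "((\<lambda>t. u (?z + t *\<^sub>R axis k 1)) has_real_derivative D k ?z) (at ((\<theta> - \<theta>) * h $ k))"
          using D[of ?z k] inb[of \<theta>] d(2) that by auto
        moreover have "((\<lambda>s. (s - \<theta>) * h $ k) has_real_derivative h $ k) (at \<theta>)"
          by (auto intro!: derivative_eq_intros)
        ultimately have "((\<lambda>s. u (?z + ((s - \<theta>) * h $ k) *\<^sub>R axis k 1)) has_real_derivative D k ?z * h $ k) (at \<theta>)"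
          by (rule DERIV_chain2)
        moreover have "?z + ((s - \<theta>) * h $ k) *\<^sub>R axis k 1 = y + (s * h $ k) *\<^sub>R axis k 1" for s
          by (simp add: algebra_simps)
        ultimately have "((\<lambda>s. u (y + (s * h $ k) *\<^sub>R axis k 1)) has_real_derivative D k ?z * h $ k) (at \<theta> within {0..1})"
          using has_field_derivative_at_within by simp
        then show ?thesis
          by (simp add: has_field_derivative_def mult_commute_abs mult.commute[of "h $ k"])
      qed
      obtain \<theta> where \<theta>: "\<theta> \<in> {0..1}" "u (y + (1 * h $ k) *\<^sub>R axis k 1) - u (y + (0 * h $ k) *\<^sub>R axis k 1)
          = (1 - 0) * (h $ k * D k (y + (\<theta> * h $ k) *\<^sub>R axis k 1))"
        using mvt_very_simple[OF _ der] by (metis zero_le_one)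
      have "\<bar>h $ k * D k (y + (\<theta> * h $ k) *\<^sub>R axis k 1) - h $ k * D k x\<bar> \<le> e' * \<bar>h $ k\<bar>"
        using mult_left_mono[OF d(3)[OF inb[OF \<theta>(1)], of k], of "\<bar>h $ k\<bar>"]
        by (simp add: abs_mult[symmetric] right_diff_distrib mult.commute)
      moreover have "x + (\<Sum>i\<in>insert k I. h $ i *\<^sub>R axis i 1) = y + h $ k *\<^sub>R axis k 1"
        using insert by (simp add: y_def)
      ultimately show ?case
        using insert.IH \<theta>(2) unfolding y_def[symmetric]
        by (simp del: sum.insert add: sum.insert[OF insert.hyps, of "\<lambda>i. h $ i * D i x"]
            sum.insert[OF insert.hyps, of "\<lambda>i. e' * \<bar>h $ i\<bar>"])
    qed auto
    have "norm (u y - u x - (\<Sum>i\<in>UNIV. (y - x) $ i * D i x)) \<le> e * norm (y - x)"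
      if "norm (y - x) < d" for y
    proof -
      have "(\<Sum>i\<in>UNIV. (y - x) $ i *\<^sub>R axis i 1) = y - x"
        by (simp add: vec_eq_iff axis_def if_distrib cong: if_cong)
      then have "norm (u y - u x - (\<Sum>i\<in>UNIV. (y - x) $ i * D i x)) \<le> (\<Sum>i\<in>UNIV. e' * \<bar>(y - x) $ i\<bar>)"
        using main[OF that, of UNIV] by simp
      also have "\<dots> \<le> (\<Sum>i\<in>(UNIV::'n set). e' * norm (y - x))"
        using \<open>e' > 0\<close> by (intro sum_mono mult_left_mono component_le_norm_cart) auto
      also have "\<dots> = e * norm (y - x)" by (simp add: e'_def)
      finally show ?thesis .
    qed
    then show ?thesis using d(1) by blast
  qed
  moreover have "bounded_linear (\<lambda>h. \<Sum>i\<in>UNIV. h $ i * D i x)"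
    by (intro bounded_linear_sum bounded_linear_mult_left bounded_linear_compose[OF bounded_linear_mult_left bounded_linear_vec_nth])
  ultimately show ?thesis
    unfolding has_derivative_at_alt by blast
qed

text \<open>\<open>Ck\<close> records partial derivatives only. The strict inequality on the length
  leaves one further order of continuous partials, which makes \<open>hpd is g\<close> totally
  differentiable.\<close>

lemma Ck_has_derivative:
  assumes "Ck r U g" "open U" "x \<in> U" "length is < r"
  shows "(hpd is g has_derivative (\<lambda>h. \<Sum>i\<in>UNIV. h $ i * hpd (i # is) g x)) (at x)"
proof (rule has_derivative_of_continuous_partials[OF assms(2,3)])
  fix i y assume "y \<in> U"
  then obtain D where "((\<lambda>t. hpd is g (y + t *\<^sub>R axis i 1)) has_real_derivative D) (at 0)"
    using assms unfolding Ck_def by (meson less_imp_le)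
  then show "((\<lambda>t. hpd is g (y + t *\<^sub>R axis i 1)) has_real_derivative hpd (i # is) g y) (at 0)"
    by (simp add: DERIV_imp_deriv)
next
  fix i show "continuous_on U (hpd (i # is) g)"
    using assms unfolding Ck_def by (metis Suc_leI length_Cons)
qed

lemma Ck_subset: "Ck r U g \<Longrightarrow> V \<subseteq> U \<Longrightarrow> Ck r V g"
  unfolding Ck_def using continuous_on_subset by blast

lemma Ck_continuous: "Ck r U g \<Longrightarrow> length is \<le> r \<Longrightarrow> continuous_on U (hpd is g)"
  unfolding Ck_def by blast

text \<open>Downward induction on the order. At order r the difference is continuous and vanishes at
  0. Below r it vanishes at the point of S nearest to x, and the mean value inequality on the
  segment from that point to x adds one factor of the distance to the bound for the next partials,
  because the distance to S along the segment never exceeds that of x.\<close>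

lemma jets_agree_imp_flat:
  fixes f g :: "real^'n \<Rightarrow> real"
  assumes U: "open U" "0 \<in> U" and f: "Ck r U f" and g: "Ck r U g"
    and S: "closed S" "0 \<in> S"
    and jet: "\<And>x is. x \<in> S \<inter> U \<Longrightarrow> length is \<le> r \<Longrightarrow> hpd is g x = hpd is f x"
    and "\<epsilon> > 0" and "length is \<le> r"
  shows "\<exists>\<delta>>0. \<forall>x\<in>cball 0 \<delta>. \<bar>hpd is g x - hpd is f x\<bar> \<le> \<epsilon> * infdist x S ^ (r - length is)"
  using assms(8,9)
proof (induction "r - length is" arbitrary: "is" \<epsilon>)
  case 0
  then have len: "length is = r" by simp
  have "continuous_on U (\<lambda>x. hpd is g x - hpd is f x)"
    using f g len by (intro continuous_intros Ck_continuous) auto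
  then have "\<exists>d>0. \<forall>y\<in>U. dist y 0 < d \<longrightarrow>
      dist (hpd is g y - hpd is f y) (hpd is g 0 - hpd is f 0) < \<epsilon>"
    using U(2) 0(2) unfolding continuous_on_iff by blast
  then obtain d where d: "d > 0" "\<And>y. y \<in> U \<Longrightarrow> dist y 0 < d \<Longrightarrow>
      dist (hpd is g y - hpd is f y) (hpd is g 0 - hpd is f 0) < \<epsilon>" by blast
  obtain d0 where d0: "d0 > 0" "cball 0 d0 \<subseteq> U" using U open_contains_cball by blast
  have "\<bar>hpd is g x - hpd is f x\<bar> \<le> \<epsilon> * infdist x S ^ (r - length is)"
    if "x \<in> cball 0 (min d0 (d / 2))" for x
  proof -
    have "x \<in> U" "dist x 0 < d" using that d0 d(1) by auto
    then show ?thesis using d(2)[of x] jet[of 0 "is"] S U len by (simp add: dist_real_def)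
  qed
  then show ?case using d(1) d0(1) by (intro exI[of _ "min d0 (d / 2)"]) auto
next
  case (Suc k)
  \<comment> \<open>The differential is a sum over N coordinates, so each partial derivative
    receives the share \<epsilon> / N.\<close>
  define N where "N = real CARD('n)"
  have "N > 0" by (simp add: N_def)
  have len: "length is < r" using Suc by simp
  have "\<exists>\<delta>>0. \<forall>x\<in>cball 0 \<delta>. \<bar>hpd (i # is) g x - hpd (i # is) f x\<bar> \<le> \<epsilon> / N * infdist x S ^ k" for i
  proof -
    have "k = r - length (i # is)" using Suc(2) by simp
    then show ?thesis using Suc(1)[of "i # is" "\<epsilon> / N"] Suc(3) len \<open>N > 0\<close> by simp
  qed
  then obtain dd where dd: "\<And>i. dd i > 0" "\<And>i x. x \<in> cball 0 (dd i) \<Longrightarrow>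
      \<bar>hpd (i # is) g x - hpd (i # is) f x\<bar> \<le> \<epsilon> / N * infdist x S ^ k" by metis
  obtain d0 where d0: "d0 > 0" "cball 0 d0 \<subseteq> U" using U open_contains_cball by blast
  \<comment> \<open>Halving makes room for the nearest point s: as 0 lies in S, |x - s| \<le> |x|,
    hence |s| \<le> 2 d, and the whole segment stays where the bounds on the partials hold.\<close>
  define d where "d = min d0 (Min (range dd)) / 2"
  have "d > 0" using d0 dd(1) by (auto simp: d_def)
  have dle: "2 * d \<le> dd i" "2 * d \<le> d0" for i
    by (auto simp: d_def min.coboundedI2)
  have "\<bar>hpd is g x - hpd is f x\<bar> \<le> \<epsilon> * infdist x S ^ (r - length is)" if x: "x \<in> cball 0 d" for x
  proof -
    obtain s where s: "s \<in> S" "infdist x S = dist x s"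
      using infdist_attains_inf[of S x] S by auto
    have "infdist x S \<le> norm x" using infdist_le[OF S(2), of x] by simp
    then have "norm s \<le> 2 * d" using s x norm_triangle_ineq4[of x "x - s"]
      by (simp add: dist_norm)
    have seg: "norm y \<le> 2 * d \<and> infdist y S \<le> infdist x S" if "y \<in> closed_segment s x" for y
    proof -
      have "y \<in> cball 0 (2 * d)"
        using that \<open>norm s \<le> 2 * d\<close> x \<open>d > 0\<close> closed_segment_subset[of s "cball 0 (2*d)" x] by auto
      moreover have "infdist y S \<le> dist y s" by (rule infdist_le[OF s(1)])
      moreover have "dist y s \<le> dist x s"
        using segment_bound(1)[OF that] by (simp add: dist_norm)
      ultimately show ?thesis using s by simp
    qed
    let ?D = "\<lambda>y. hpd is g y - hpd is f y"
    let ?D' = "\<lambda>y h. (\<Sum>i\<in>UNIV. h $ i * hpd (i # is) g y) - (\<Sum>i\<in>UNIV. h $ i * hpd (i # is) f y)"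
    have inU: "y \<in> U" if "y \<in> closed_segment s x" for y
      using seg[OF that] dle(2) d0(2) by auto
    have "norm (?D x - ?D s) \<le> (\<epsilon> * infdist x S ^ k) * norm (x - s)"
    proof (rule differentiable_bound[of "closed_segment s x" ?D ?D'])
      fix y assume y: "y \<in> closed_segment s x"
      show "(?D has_derivative ?D' y) (at y within closed_segment s x)"
        using Ck_has_derivative[OF g U(1) inU[OF y] len] Ck_has_derivative[OF f U(1) inU[OF y] len]
        by (rule has_derivative_at_withinI[OF has_derivative_diff])
      show "onorm (?D' y) \<le> \<epsilon> * infdist x S ^ k"
      proof (rule onorm_bound)
        show "0 \<le> \<epsilon> * infdist x S ^ k" using Suc(3) by (simp add: infdist_nonneg)
        fix h :: "real^'n"
        have "norm (?D' y h) = \<bar>\<Sum>i\<in>UNIV. h $ i * (hpd (i # is) g y - hpd (i # is) f y)\<bar>"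
          by (simp add: sum_subtractf right_diff_distrib)
        also have "\<dots> \<le> (\<Sum>i\<in>(UNIV::'n set). norm h * (\<epsilon> / N * infdist x S ^ k))"
        proof (rule order_trans[OF sum_abs], rule sum_mono)
          fix i
          have "\<bar>hpd (i # is) g y - hpd (i # is) f y\<bar> \<le> \<epsilon> / N * infdist y S ^ k"
            using seg[OF y] dle(1)[of i] by (intro dd(2)) auto
          also have "\<dots> \<le> \<epsilon> / N * infdist x S ^ k"
            using seg[OF y] Suc(3) \<open>N > 0\<close> by (intro mult_left_mono power_mono) (auto simp: infdist_nonneg)
          finally show "\<bar>h $ i * (hpd (i # is) g y - hpd (i # is) f y)\<bar> \<le> norm h * (\<epsilon> / N * infdist x S ^ k)"
            unfolding abs_mult by (intro mult_mono component_le_norm_cart) auto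
        qed
        also have "\<dots> = \<epsilon> * infdist x S ^ k * norm h" using \<open>N > 0\<close> by (simp add: N_def)
        finally show "norm (?D' y h) \<le> \<epsilon> * infdist x S ^ k * norm h" .
      qed
    qed auto
    moreover have "?D s = 0" using jet[of s "is"] s inU[of s] len by simp
    moreover have "r - length is = Suc k" using Suc(2) by simp
    ultimately show ?thesis using s by (simp add: dist_norm mult.commute mult.left_commute)
  qed
  then show ?case using \<open>d > 0\<close> by blast
qed

section \<open>Flows of vector fields dominated by the distance to S\<close>

text \<open>By the bound on u', \<open>exp (- C * t) * u t\<close> is nonincreasing and
  \<open>exp (C * t) * u t\<close> is nondecreasing. Both directions of time are needed: the inverse
  of the time-one map and the preservation of zeros use estimates from time 1 back to time 0. As the
  time interval has unit length, \<open>exp C\<close> serves for all pairs of times.\<close>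

lemma gronwall_two_sided:
  fixes u u' :: "real \<Rightarrow> real"
  assumes der: "\<And>t. t \<in> {0..1} \<Longrightarrow> (u has_real_derivative u' t) (at t within {0..1})"
    and bound: "\<And>t. t \<in> {0..1} \<Longrightarrow> \<bar>u' t\<bar> \<le> C * u t"
    and "s \<in> {0..1}" "t \<in> {0..1}" "0 \<le> C" "0 \<le> u s"
  shows "u t \<le> exp C * u s"
proof (cases "s \<le> t")
  case True
  have d: "((\<lambda>t. exp (- C * t) * u t) has_derivative (\<lambda>h. (exp (- C * x) * (u' x - C * u x)) * h))
      (at x within {s..t})" if "s \<le> x" "x \<le> t" for x
  proof -
    have "(u has_real_derivative u' x) (at x within {s..t})"
      using der[of x] that assms(3,4) by (auto intro: DERIV_subset)
    then show ?thesis unfolding has_field_derivative_def[symmetric]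
      by (auto intro!: derivative_eq_intros simp: algebra_simps)
  qed
  obtain x where x: "x \<in> {s..t}"
    "exp (- C * t) * u t - exp (- C * s) * u s = exp (- C * x) * (u' x - C * u x) * (t - s)"
    using mvt_very_simple[OF True d] by blast
  have "u' x - C * u x \<le> 0" using bound[of x] x assms(3,4) by auto
  then have "exp (- C * x) * (u' x - C * u x) * (t - s) \<le> 0"
    using True by (simp add: mult_nonneg_nonpos mult_nonpos_nonneg)
  then have "exp (- C * t) * u t \<le> exp (- C * s) * u s" using x by linarith
  then have "exp (C * t) * (exp (- C * t) * u t) \<le> exp (C * t) * (exp (- C * s) * u s)"
    by (rule mult_left_mono) auto
  then have "u t \<le> exp (C * (t - s)) * u s"
    by (simp add: mult.assoc[symmetric] exp_add[symmetric] right_diff_distrib)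
  also have "\<dots> \<le> exp C * u s"
    using assms mult_left_le[of "t - s" C] by (intro mult_right_mono) auto
  finally show ?thesis .
next
  case False
  then have ts: "t \<le> s" by simp
  have d: "((\<lambda>t. exp (C * t) * u t) has_derivative (\<lambda>h. (exp (C * x) * (u' x + C * u x)) * h))
      (at x within {t..s})" if "t \<le> x" "x \<le> s" for x
  proof -
    have "(u has_real_derivative u' x) (at x within {t..s})"
      using der[of x] that assms(3,4) by (auto intro: DERIV_subset)
    then show ?thesis unfolding has_field_derivative_def[symmetric]
      by (auto intro!: derivative_eq_intros simp: algebra_simps)
  qed
  obtain x where x: "x \<in> {t..s}"
    "exp (C * s) * u s - exp (C * t) * u t = exp (C * x) * (u' x + C * u x) * (s - t)"
    using mvt_very_simple[OF ts d] by blast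
  have "0 \<le> u' x + C * u x" using bound[of x] x assms(3,4) by auto
  then have "0 \<le> exp (C * x) * (u' x + C * u x) * (s - t)"
    using ts by simp
  then have "exp (C * t) * u t \<le> exp (C * s) * u s" using x by linarith
  then have "exp (- C * t) * (exp (C * t) * u t) \<le> exp (- C * t) * (exp (C * s) * u s)"
    by (rule mult_left_mono) auto
  then have "u t \<le> exp (C * (s - t)) * u s"
    by (simp add: mult.assoc[symmetric] exp_add[symmetric] right_diff_distrib)
  also have "\<dots> \<le> exp C * u s"
    using assms mult_left_le[of "s - t" C] by (intro mult_right_mono) auto
  finally show ?thesis .
qed

section \<open>Integral curves on the unit time interval\<close>

definition integral_curve :: "(real \<Rightarrow> 'a::euclidean_space \<Rightarrow> 'a) \<Rightarrow> real \<Rightarrow> (real \<Rightarrow> 'a) \<Rightarrow> bool" where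
  "integral_curve X \<rho> \<gamma> \<longleftrightarrow> (\<forall>t\<in>{0..1}. \<gamma> t \<in> cball 0 \<rho> \<and>
     (\<gamma> has_vector_derivative X t (\<gamma> t)) (at t within {0..1}))"

text \<open>The Lipschitz constant L may depend on e and grow without bound as e tends to 0. The
  pointwise bound forces the field to vanish on S and replaces the missing Lipschitz condition
  there.\<close>

definition subordinate_field :: "'a::euclidean_space set \<Rightarrow> real \<Rightarrow> (real \<Rightarrow> 'a \<Rightarrow> 'a) \<Rightarrow> bool" where
  "subordinate_field S \<rho> X \<longleftrightarrow> closed S \<and> 0 \<in> S \<and> 0 < \<rho> \<and>
     (\<forall>t\<in>{0..1}. \<forall>x\<in>cball 0 \<rho>. norm (X t x) \<le> infdist x S / 4) \<and>
     (\<forall>e>0. \<exists>L. L-lipschitz_on ({0..1} \<times> {x\<in>cball 0 \<rho>. e \<le> infdist x S}) (\<lambda>(t, x). X t x))"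

lemma infdist_le_norm: "0 \<in> S \<Longrightarrow> infdist x S \<le> norm x" for x :: "'a::real_normed_vector"
  using infdist_le[of 0 S x] by simp

text \<open>Time reversal turns terminal value problems into initial value problems; curves with
  prescribed value at time 1 supply the inverse of the time-one map.\<close>

lemma subordinate_field_reverse:
  assumes "subordinate_field S \<rho> X"
  shows "subordinate_field S \<rho> (\<lambda>t x. - X (1 - t) x)"
  unfolding subordinate_field_def
proof (intro conjI allI impI ballI)
  fix e :: real assume "e > 0"
  then obtain L where L: "L-lipschitz_on ({0..1} \<times> {x\<in>cball 0 \<rho>. e \<le> infdist x S}) (\<lambda>(t, x). X t x)"
    using assms unfolding subordinate_field_def by blast
  have "L-lipschitz_on ({0..1} \<times> {x\<in>cball 0 \<rho>. e \<le> infdist x S}) (\<lambda>(t, x). - X (1 - t) x)"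
  proof (rule lipschitz_onI)
    fix p q :: "real \<times> 'a"
    assume p: "p \<in> {0..1} \<times> {x\<in>cball 0 \<rho>. e \<le> infdist x S}"
      and q: "q \<in> {0..1} \<times> {x\<in>cball 0 \<rho>. e \<le> infdist x S}"
    obtain t x s y where pq: "p = (t, x)" "q = (s, y)" by fastforce
    have "dist (X (1 - t) x) (X (1 - s) y) \<le> L * dist (1 - t, x) (1 - s, y)"
      using lipschitz_onD[OF L, of "(1 - t, x)" "(1 - s, y)"] p q pq by auto
    then show "dist (case p of (t, x) \<Rightarrow> - X (1 - t) x) (case q of (t, x) \<Rightarrow> - X (1 - t) x) \<le> L * dist p q"
      by (simp add: pq dist_minus dist_Pair_Pair dist_real_def abs_minus_commute)
  qed (use lipschitz_on_nonneg[OF L] in auto)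
  then show "\<exists>L. L-lipschitz_on ({0..1} \<times> {x\<in>cball 0 \<rho>. e \<le> infdist x S}) (\<lambda>(t, x). - X (1 - t) x)" ..
qed (use assms in \<open>auto simp: subordinate_field_def\<close>)

lemma integral_curve_reverse:
  assumes "integral_curve X \<rho> \<gamma>"
  shows "integral_curve (\<lambda>t x. - X (1 - t) x) \<rho> (\<lambda>t. \<gamma> (1 - t))"
  unfolding integral_curve_def
proof
  fix t :: real assume t: "t \<in> {0..1}"
  have im: "(\<lambda>t. 1 - t) ` {0..1} = {0..1::real}"
    by (auto simp: image_iff intro: bexI[of _ "1 - _"])
  have "(\<gamma> has_vector_derivative X (1 - t) (\<gamma> (1 - t))) (at (1 - t) within (\<lambda>t. 1 - t) ` {0..1})"
    using assms t unfolding integral_curve_def im by auto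
  moreover have "((\<lambda>t. 1 - t) has_vector_derivative (-1)) (at t within {0..1})"
    by (auto intro!: derivative_eq_intros)
  ultimately have "((\<gamma> \<circ> (\<lambda>t. 1 - t)) has_vector_derivative (-1) *\<^sub>R X (1 - t) (\<gamma> (1 - t))) (at t within {0..1})"
    by (rule vector_diff_chain_within[rotated])
  then show "\<gamma> (1 - t) \<in> cball 0 \<rho> \<and> ((\<lambda>t. \<gamma> (1 - t)) has_vector_derivative - X (1 - t) (\<gamma> (1 - t))) (at t within {0..1})"
    using assms t unfolding integral_curve_def by (auto simp: o_def)
qed

lemma integral_curve_continuous: "integral_curve X \<rho> \<gamma> \<Longrightarrow> continuous_on {0..1} \<gamma>"
  unfolding integral_curve_def continuous_on_eq_continuous_within
  using has_vector_derivative_continuous by blast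

text \<open>A speed of at most a quarter of the distance to S confines a curve, during a unit of
  time, to a ball whose radius is a third of that distance: no exponential bound is needed.\<close>

lemma integral_curve_dist_le:
  assumes X: "subordinate_field S \<rho> X" and \<gamma>: "integral_curve X \<rho> \<gamma>"
    and s: "s \<in> {0..1}" and t: "t \<in> {0..1}"
  shows "norm (\<gamma> s - \<gamma> t) \<le> infdist (\<gamma> t) S / 3"
proof -
  have "continuous_on {0..1} (\<lambda>s. norm (\<gamma> s - \<gamma> t))"
    using integral_curve_continuous[OF \<gamma>] by (intro continuous_intros)
  then obtain m where m: "m \<in> {0..1}" "\<And>s. s \<in> {0..1} \<Longrightarrow> norm (\<gamma> s - \<gamma> t) \<le> norm (\<gamma> m - \<gamma> t)"
    using continuous_attains_sup[of "{0..1::real}" "\<lambda>s. norm (\<gamma> s - \<gamma> t)"] by auto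
  define M where "M = norm (\<gamma> m - \<gamma> t)"
  \<comment> \<open>The speed bound involves the maximal displacement M itself, but with a factor
    below one: M \<le> (D + M) / 4, with D the distance of \<gamma> t to S, rearranges to M \<le> D
    / 3.\<close>
  have "norm (\<gamma> m - \<gamma> t) \<le> (infdist (\<gamma> t) S + M) / 4 * norm (m - t)"
  proof (rule differentiable_bound[of "{0..1}" \<gamma> "\<lambda>x h. h *\<^sub>R X x (\<gamma> x)"])
    fix x :: real assume x: "x \<in> {0..1}"
    show "(\<gamma> has_derivative (\<lambda>h. h *\<^sub>R X x (\<gamma> x))) (at x within {0..1})"
      using \<gamma> x unfolding integral_curve_def has_vector_derivative_def by blast
    have "norm (X x (\<gamma> x)) \<le> infdist (\<gamma> x) S / 4"
      using X \<gamma> x unfolding subordinate_field_def integral_curve_def by blast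
    also have "infdist (\<gamma> x) S \<le> infdist (\<gamma> t) S + M"
      using infdist_triangle[of "\<gamma> x" S "\<gamma> t"] m(2)[OF x] by (simp add: dist_norm M_def)
    finally have "norm (X x (\<gamma> x)) \<le> (infdist (\<gamma> t) S + M) / 4" by simp
    then show "onorm (\<lambda>h. h *\<^sub>R X x (\<gamma> x)) \<le> (infdist (\<gamma> t) S + M) / 4"
      by (intro onorm_bound)
        (auto simp: M_def infdist_nonneg mult.commute[of "\<bar>_\<bar>"] simp del: times_divide_eq_left
          intro: mult_right_mono)
  qed (use m t in auto)
  also have "\<dots> \<le> (infdist (\<gamma> t) S + M) / 4"
    using m(1) t by (intro mult_left_le) (auto simp: M_def infdist_nonneg)
  finally have "M \<le> infdist (\<gamma> t) S / 3" by (simp add: M_def)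
  then show ?thesis using m(2)[OF s] by (simp add: M_def)
qed

text \<open>The factor is 1 - 1/3, by the displacement bound. As s and t are not ordered, a curve
  neither reaches S from outside nor leaves it.\<close>

lemma integral_curve_infdist_ge:
  assumes "subordinate_field S \<rho> X" "integral_curve X \<rho> \<gamma>" "s \<in> {0..1}" "t \<in> {0..1}"
  shows "2 / 3 * infdist (\<gamma> t) S \<le> infdist (\<gamma> s) S"
  using integral_curve_dist_le[OF assms] infdist_triangle[of "\<gamma> t" S "\<gamma> s"]
  by (simp add: dist_norm norm_minus_commute)

text \<open>Both curves remain where the distance is at least 2/3 e, so a single Lipschitz constant
  L governs them, and Gronwall applies to the squared distance of the curves, which unlike the
  distance is differentiable everywhere. One C serves all pairs of curves, as continuity of the flow
  requires.\<close>

lemma integral_curves_lipschitz: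
  assumes X: "subordinate_field S \<rho> X" and "0 < e"
  shows "\<exists>C\<ge>0. \<forall>\<gamma> \<beta> s t. integral_curve X \<rho> \<gamma> \<and> integral_curve X \<rho> \<beta> \<and> s \<in> {0..1} \<and> t \<in> {0..1}
    \<and> e \<le> infdist (\<gamma> s) S \<and> e \<le> infdist (\<beta> s) S \<longrightarrow> norm (\<gamma> t - \<beta> t) \<le> C * norm (\<gamma> s - \<beta> s)"
proof -
  define e' where "e' = 2 / 3 * e"
  have "e' > 0" using assms by (simp add: e'_def)
  then obtain L where L: "L-lipschitz_on ({0..1} \<times> {x\<in>cball 0 \<rho>. e' \<le> infdist x S}) (\<lambda>(t, x). X t x)"
    using X unfolding subordinate_field_def by blast
  have "0 \<le> L" using lipschitz_on_nonneg[OF L] .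
  have "norm (\<gamma> t - \<beta> t) \<le> exp L * norm (\<gamma> s - \<beta> s)"
    if \<gamma>: "integral_curve X \<rho> \<gamma>" and \<beta>: "integral_curve X \<rho> \<beta>" and s: "s \<in> {0..1}" and t: "t \<in> {0..1}"
      and es: "e \<le> infdist (\<gamma> s) S" "e \<le> infdist (\<beta> s) S" for \<gamma> \<beta> s t
  proof -
    let ?u = "\<lambda>t. (\<gamma> t - \<beta> t) \<bullet> (\<gamma> t - \<beta> t)"
    let ?u' = "\<lambda>t. 2 * ((\<gamma> t - \<beta> t) \<bullet> (X t (\<gamma> t) - X t (\<beta> t)))"
    have "?u t \<le> exp (2 * L) * ?u s"
    proof (rule gronwall_two_sided[of ?u ?u'])
      fix x :: real assume x: "x \<in> {0..1}"
      have "((\<lambda>t. \<gamma> t - \<beta> t) has_derivative (\<lambda>h. h *\<^sub>R (X x (\<gamma> x) - X x (\<beta> x)))) (at x within {0..1})"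
        using \<gamma> \<beta> x unfolding integral_curve_def has_vector_derivative_def[symmetric]
        by (intro has_vector_derivative_diff) auto
      then have "(?u has_derivative (\<lambda>h. (\<gamma> x - \<beta> x) \<bullet> (h *\<^sub>R (X x (\<gamma> x) - X x (\<beta> x)))
          + (h *\<^sub>R (X x (\<gamma> x) - X x (\<beta> x))) \<bullet> (\<gamma> x - \<beta> x))) (at x within {0..1})"
        using has_derivative_inner by blast
      then show "(?u has_real_derivative ?u' x) (at x within {0..1})"
        unfolding has_field_derivative_def
        by (rule has_derivative_eq_rhs) (auto simp: fun_eq_iff inner_commute)
      have "e' \<le> infdist (\<gamma> x) S" "e' \<le> infdist (\<beta> x) S"
        using integral_curve_infdist_ge[OF X \<gamma> x s] integral_curve_infdist_ge[OF X \<beta> x s] es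
        by (auto simp: e'_def)
      then have "norm (X x (\<gamma> x) - X x (\<beta> x)) \<le> L * norm (\<gamma> x - \<beta> x)"
        using lipschitz_on_normD[OF L, of "(x, \<gamma> x)" "(x, \<beta> x)"] x \<gamma> \<beta>
        unfolding integral_curve_def by (simp add: norm_Pair)
      then have "\<bar>(\<gamma> x - \<beta> x) \<bullet> (X x (\<gamma> x) - X x (\<beta> x))\<bar> \<le> norm (\<gamma> x - \<beta> x) * (L * norm (\<gamma> x - \<beta> x))"
        using Cauchy_Schwarz_ineq2 mult_left_mono norm_ge_zero order_trans by metis
      also have "\<dots> = L * ?u x" by (simp add: power2_norm_eq_inner[symmetric] power2_eq_square)
      finally show "\<bar>?u' x\<bar> \<le> 2 * L * ?u x" by simp
    qed (use s t \<open>0 \<le> L\<close> in auto)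
    then have "(norm (\<gamma> t - \<beta> t))\<^sup>2 \<le> (exp L * norm (\<gamma> s - \<beta> s))\<^sup>2"
      by (simp add: power2_norm_eq_inner[symmetric] power_mult_distrib exp_double[symmetric])
    then show ?thesis by (rule power2_le_imp_le) auto
  qed
  then show ?thesis by (intro exI[of _ "exp L"]) auto
qed

text \<open>At points of S no Lipschitz estimate is available, but there the displacement bound pins
  both curves to their common point.\<close>

lemma integral_curve_unique:
  assumes X: "subordinate_field S \<rho> X" and \<gamma>: "integral_curve X \<rho> \<gamma>" and \<beta>: "integral_curve X \<rho> \<beta>"
    and s: "s \<in> {0..1}" and t: "t \<in> {0..1}" and eq: "\<gamma> s = \<beta> s"
  shows "\<gamma> t = \<beta> t"
proof (cases "infdist (\<gamma> s) S = 0")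
  case True
  then show ?thesis
    using integral_curve_dist_le[OF X \<gamma> t s] integral_curve_dist_le[OF X \<beta> t s] eq by simp
next
  case False
  then have "0 < infdist (\<gamma> s) S" using infdist_nonneg[of "\<gamma> s" S] by linarith
  from integral_curves_lipschitz[OF X this] obtain C where
    "norm (\<gamma> t - \<beta> t) \<le> C * norm (\<gamma> s - \<beta> s)" using \<gamma> \<beta> s t eq by (metis order_refl)
  then show ?thesis using eq by simp
qed

text \<open>Picard iteration is run on curves u rescaled by exp (- k t), for which the iteration is a
  contraction on the whole unit interval. The closed ball of radius a third of the distance to S is
  invariant, so no cut-off of the field is needed.\<close>

lemma integral_curve_exists:
  assumes X: "subordinate_field S \<rho> X" and x0: "norm x0 \<le> 3 / 4 * \<rho>"
  shows "\<exists>\<gamma>. integral_curve X \<rho> \<gamma> \<and> \<gamma> 0 = x0"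
proof (cases "x0 \<in> S")
  case True
  have "norm x0 \<le> \<rho>" using x0 X by (auto simp: subordinate_field_def)
  then have "X t x0 = 0" if "t \<in> {0..1}" for t
    using X that True by (force simp: subordinate_field_def)
  then have "integral_curve X \<rho> (\<lambda>_. x0)"
    using \<open>norm x0 \<le> \<rho>\<close> by (auto simp: integral_curve_def)
  then show ?thesis by blast
next
  case False
  define d where "d = infdist x0 S"
  have S: "closed S" "0 \<in> S" and "0 < \<rho>" using X by (auto simp: subordinate_field_def)
  have "0 < d" using infdist_pos_not_in_closed[of S x0] S False by (auto simp: d_def)
  have "d \<le> norm x0" using infdist_le_norm[OF S(2)] by (simp add: d_def)
  \<comment> \<open>Since d \<le> |x0| \<le> 3/4 \<rho>, a point within d / 3 of x0 has norm at most
    4/3 * 3/4 \<rho> = \<rho>; this is where the radius 3/4 \<rho> for starting points comes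
    from.\<close>
  have B: "norm y \<le> \<rho>" "2 / 3 * d \<le> infdist y S" "infdist y S \<le> 4 / 3 * d"
    if "norm (y - x0) \<le> d / 3" for y
  proof -
    have "norm y \<le> norm x0 + norm (y - x0)" using norm_triangle_sub by blast
    then show "norm y \<le> \<rho>" using that \<open>d \<le> norm x0\<close> x0 by linarith
    show "2 / 3 * d \<le> infdist y S" "infdist y S \<le> 4 / 3 * d"
      using infdist_triangle[of y S x0] infdist_triangle[of x0 S y] that
      by (auto simp: d_def dist_norm norm_minus_commute)
  qed
  have "0 < 2 / 3 * d" using \<open>0 < d\<close> by simp
  then obtain L where L: "L-lipschitz_on ({0..1} \<times> {x\<in>cball 0 \<rho>. 2 / 3 * d \<le> infdist x S}) (\<lambda>(t, x). X t x)"
    using X unfolding subordinate_field_def by blast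
  have "0 \<le> L" using lipschitz_on_nonneg[OF L] .
  \<comment> \<open>The weighted iteration contracts by the factor L / k \<le> 1/2; the summand 1
    keeps k positive when L = 0.\<close>
  define k where "k = 2 * L + 1"
  have "k > 0" using \<open>0 \<le> L\<close> by (simp add: k_def)
  define y where "y = (\<lambda>(u::real \<Rightarrow>\<^sub>C 'a) s. exp (k * s) *\<^sub>R u s)"
  \<comment> \<open>The invariant ball around x0, rescaled pointwise. In this form it is a closed
    set of bounded continuous functions, hence complete.\<close>
  define Q where "Q = PiC {0..1::real} (\<lambda>t. cball (exp (- k * t) *\<^sub>R x0) (exp (- k * t) * (d / 3)))"
  have Q_iff: "u \<in> Q \<longleftrightarrow> (\<forall>t\<in>{0..1}. norm (y u t - x0) \<le> d / 3)" for u
  proof -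
    have "dist (exp (- k * t) *\<^sub>R x0) (u t) = exp (- k * t) * norm (y u t - x0)" for t
    proof -
      have "u t = exp (- k * t) *\<^sub>R y u t" by (simp add: y_def exp_minus)
      then have "dist (exp (- k * t) *\<^sub>R x0) (u t) = norm (exp (- k * t) *\<^sub>R (x0 - y u t))"
        by (simp add: dist_norm scaleR_right_diff_distrib)
      then show ?thesis by (simp add: norm_minus_commute)
    qed
    then show ?thesis by (auto simp: Q_def mem_PiC_iff Pi_iff)
  qed
  have contX: "continuous_on {0..1} (\<lambda>s. X s (y u s))" if "u \<in> Q" for u
  proof -
    have "continuous_on {0..1} ((\<lambda>(t, x). X t x) \<circ> (\<lambda>s. (s, y u s)))"
    proof (rule continuous_on_compose)
      show "continuous_on {0..1} (\<lambda>s. (s, y u s))"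
        unfolding y_def by (intro continuous_intros continuous_on_apply_bcontfun)
      have "(\<lambda>s. (s, y u s)) ` {0..1} \<subseteq> {0..1} \<times> {x\<in>cball 0 \<rho>. 2 / 3 * d \<le> infdist x S}"
        using that B by (auto simp: Q_iff)
      then show "continuous_on ((\<lambda>s. (s, y u s)) ` {0..1}) (\<lambda>(t, x). X t x)"
        using lipschitz_on_continuous_on[OF L] continuous_on_subset by blast
    qed
    then show ?thesis by (simp add: o_def)
  qed
  define P where "P = (\<lambda>u t. x0 + integral {0..t} (\<lambda>s. X s (y u s)))"
  have P_cont: "continuous_on {0..1} (P u)" if "u \<in> Q" for u
    unfolding P_def using contX[OF that]
    by (intro continuous_intros indefinite_integral_continuous_1 integrable_continuous_real)
  have P_ball: "norm (P u t - x0) \<le> d / 3" if "u \<in> Q" "t \<in> {0..1}" for u t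
  proof -
    have "norm (integral {0..t} (\<lambda>s. X s (y u s))) \<le> integral {0..t} (\<lambda>s. d / 3)"
    proof (rule integral_norm_bound_integral)
      show "(\<lambda>s. X s (y u s)) integrable_on {0..t}"
        using contX[OF that(1)] that(2)
        by (intro integrable_continuous_real continuous_on_subset[OF contX[OF that(1)]]) auto
      fix s assume "s \<in> {0..t}"
      then have s: "s \<in> {0..1}" and n: "norm (y u s - x0) \<le> d / 3" using that by (auto simp: Q_iff)
      \<comment> \<open>A quarter of the largest distance 4/3 d in the ball is d / 3, so the radius
        reproduces itself in unit time.\<close>
      have "norm (X s (y u s)) \<le> infdist (y u s) S / 4"
        using X s B(1)[OF n] unfolding subordinate_field_def by auto
      then show "norm (X s (y u s)) \<le> d / 3" using B(3)[OF n] by simp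
    qed auto
    also have "\<dots> \<le> d / 3" using that \<open>0 < d\<close> mult_right_mono[of t 1 "d / 3"] by simp
    finally show ?thesis by (simp add: P_def)
  qed
  \<comment> \<open>Bounded continuous functions live on the whole real line; \<open>clamp\<close>
    extends a curve from the unit interval by its end values.\<close>
  have ex: "\<exists>v. v \<in> Q \<and> (\<forall>t. v t = exp (- k * clamp 0 1 t) *\<^sub>R q (clamp 0 1 t))"
    if q: "continuous_on {0..1} q" "\<And>t. t \<in> {0..1} \<Longrightarrow> norm (q t - x0) \<le> d / 3" for q
  proof -
    have "continuous_on (cbox 0 1) (\<lambda>t. exp (- k * t) *\<^sub>R q t)"
      using q(1) by (auto intro!: continuous_intros)
    then obtain v :: "real \<Rightarrow>\<^sub>C 'a" where v: "\<And>t. t \<in> cbox 0 1 \<Longrightarrow> v t = exp (- k * t) *\<^sub>R q t"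
      "\<And>t. v t = exp (- k * clamp 0 1 t) *\<^sub>R q (clamp 0 1 t)"
      by (rule continuous_on_cbox_bcontfunE) auto
    have "y v t = q t" if "t \<in> {0..1}" for t
      using v(1)[of t] that by (simp add: y_def exp_minus)
    then have "v \<in> Q" using q(2) by (simp add: Q_iff)
    then show ?thesis using v(2) by blast
  qed
  have "\<exists>T. \<forall>u\<in>Q. T u \<in> Q \<and> (\<forall>t. (T u :: real \<Rightarrow>\<^sub>C 'a) t = exp (- k * clamp 0 1 t) *\<^sub>R P u (clamp 0 1 t))"
    by (rule bchoice) (use ex P_cont P_ball in blast)
  then obtain T :: "(real \<Rightarrow>\<^sub>C 'a) \<Rightarrow> (real \<Rightarrow>\<^sub>C 'a)" where T: "\<And>u. u \<in> Q \<Longrightarrow> T u \<in> Q"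
    "\<And>u t. u \<in> Q \<Longrightarrow> T u t = exp (- k * clamp 0 1 t) *\<^sub>R P u (clamp 0 1 t)" by blast
  have contraction: "dist (T u) (T v) \<le> 1 / 2 * dist u v" if uv: "u \<in> Q" "v \<in> Q" for u v
  proof (rule dist_bound)
    fix t :: real
    define \<tau> where "\<tau> = clamp 0 1 t"
    have \<tau>: "\<tau> \<in> {0..1}" using clamp_in_interval[of 0 "1::real" t] by (simp add: \<tau>_def)
    define D where "D = dist u v"
    have int: "(\<lambda>s. X s (y w s)) integrable_on {0..\<tau>}" if "w \<in> Q" for w
      using \<tau> by (intro integrable_continuous_real continuous_on_subset[OF contX[OF that]]) auto
    have expint: "((\<lambda>s. L * D * exp (k * s)) has_integral (L * D * exp (k * \<tau>) / k - L * D * exp (k * 0) / k)) {0..\<tau>}"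
      using \<tau> \<open>k > 0\<close> by (intro fundamental_theorem_of_calculus)
        (auto intro!: derivative_eq_intros simp: has_real_derivative_iff_has_vector_derivative[symmetric])
    have "norm (P u \<tau> - P v \<tau>) = norm (integral {0..\<tau>} (\<lambda>s. X s (y u s) - X s (y v s)))"
      using int uv by (simp add: P_def integral_diff)
    also have "\<dots> \<le> integral {0..\<tau>} (\<lambda>s. L * D * exp (k * s))"
    proof (rule integral_norm_bound_integral)
      show "(\<lambda>s. X s (y u s) - X s (y v s)) integrable_on {0..\<tau>}" using int uv by (intro integrable_diff)
      show "(\<lambda>s. L * D * exp (k * s)) integrable_on {0..\<tau>}" using expint by blast
      fix s assume "s \<in> {0..\<tau>}"
      then have s: "s \<in> {0..1}" using \<tau> by auto
      then have "norm (y u s - x0) \<le> d / 3" "norm (y v s - x0) \<le> d / 3" using uv by (auto simp: Q_iff)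
      then have "norm (X s (y u s) - X s (y v s)) \<le> L * norm (y u s - y v s)"
        using lipschitz_on_normD[OF L, of "(s, y u s)" "(s, y v s)"] s B by (simp add: norm_Pair)
      also have "norm (y u s - y v s) = exp (k * s) * norm (u s - v s)"
        by (simp add: y_def scaleR_right_diff_distrib[symmetric])
      also have "L * \<dots> \<le> L * (exp (k * s) * D)"
        using \<open>0 \<le> L\<close> dist_bounded[of u s v] by (intro mult_left_mono) (auto simp: D_def dist_norm)
      finally show "norm (X s (y u s) - X s (y v s)) \<le> L * D * exp (k * s)"
        by (simp add: mult_ac)
    qed
    also have "\<dots> = L * D * exp (k * \<tau>) / k - L * D * exp (k * 0) / k" using expint by blast
    also have "\<dots> \<le> L * D * exp (k * \<tau>) / k" using \<open>0 \<le> L\<close> \<open>k > 0\<close> by (simp add: D_def)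
    also have "\<dots> = (L / k) * (D * exp (k * \<tau>))" by simp
    also have "\<dots> \<le> 1 / 2 * (D * exp (k * \<tau>))"
      using \<open>0 \<le> L\<close> \<open>k > 0\<close> by (intro mult_right_mono) (auto simp: k_def D_def field_simps)
    finally have "norm (P u \<tau> - P v \<tau>) \<le> 1 / 2 * (D * exp (k * \<tau>))" .
    then have "exp (- k * \<tau>) * norm (P u \<tau> - P v \<tau>) \<le> exp (- k * \<tau>) * (1 / 2 * (D * exp (k * \<tau>)))"
      by (intro mult_left_mono) auto
    also have "\<dots> = 1 / 2 * D" by (simp add: exp_minus)
    finally have "exp (- k * \<tau>) * norm (P u \<tau> - P v \<tau>) \<le> 1 / 2 * D" .
    moreover have "dist (T u t) (T v t) = exp (- k * \<tau>) * norm (P u \<tau> - P v \<tau>)"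
      using uv by (simp add: T(2) \<tau>_def dist_norm scaleR_right_diff_distrib[symmetric])
    ultimately show "dist (T u t) (T v t) \<le> 1 / 2 * dist u v" by (simp add: D_def)
  qed
  have "complete Q" unfolding Q_def by (simp add: closed_PiC complete_eq_closed)
  moreover have "Q \<noteq> {}" using ex[of "\<lambda>_. x0"] \<open>0 < d\<close> by auto
  moreover have "T ` Q \<subseteq> Q" using T(1) by blast
  ultimately obtain u where u: "u \<in> Q" "T u = u"
    using Banach_fix[of Q "1 / 2" T] contraction by auto
  define \<gamma> where "\<gamma> = y u"
  have \<gamma>_eq: "\<gamma> t = P u t" if "t \<in> {0..1}" for t
  proof -
    have "clamp 0 1 t = t" using that by (intro clamp_cancel_cbox) auto
    then have "u t = exp (- k * t) *\<^sub>R P u t" using T(2)[OF u(1), of t] u(2) by simp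
    then show ?thesis by (simp add: \<gamma>_def y_def exp_minus)
  qed
  have "integral_curve X \<rho> \<gamma>"
    unfolding integral_curve_def
  proof
    fix t :: real assume t: "t \<in> {0..1}"
    have "(P u has_vector_derivative X t (y u t)) (at t within {0..1})"
      unfolding P_def using integral_has_vector_derivative[OF contX[OF u(1)] t]
      by (auto intro!: derivative_eq_intros)
    then have "(\<gamma> has_vector_derivative X t (\<gamma> t)) (at t within {0..1})"
      unfolding \<gamma>_def[symmetric] by (rule has_vector_derivative_transform[OF t, rotated]) (simp add: \<gamma>_eq)
    moreover have "norm (\<gamma> t) \<le> \<rho>" using u(1) t B(1) by (auto simp: \<gamma>_def Q_iff)
    ultimately show "\<gamma> t \<in> cball 0 \<rho> \<and> (\<gamma> has_vector_derivative X t (\<gamma> t)) (at t within {0..1})" by simp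
  qed
  moreover have "\<gamma> 0 = x0" by (simp add: \<gamma>_eq P_def)
  ultimately show ?thesis by blast
qed

lemma integral_curve_exists_terminal:
  assumes X: "subordinate_field S \<rho> X" and x0: "norm x0 \<le> 3 / 4 * \<rho>"
  shows "\<exists>\<gamma>. integral_curve X \<rho> \<gamma> \<and> \<gamma> 1 = x0"
proof -
  obtain \<gamma> where \<gamma>: "integral_curve (\<lambda>t x. - X (1 - t) x) \<rho> \<gamma>" "\<gamma> 0 = x0"
    using integral_curve_exists[OF subordinate_field_reverse[OF X] x0] by blast
  from integral_curve_reverse[OF this(1)] have "integral_curve X \<rho> (\<lambda>t. \<gamma> (1 - t))" by simp
  then show ?thesis using \<gamma>(2) by (intro exI[of _ "\<lambda>t. \<gamma> (1 - t)"]) simp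
qed

text \<open>Off S this is the uniform Lipschitz estimate. At x in S, a nearby y is displaced by at
  most a third of its distance to S, thus by at most |y - x| / 3. The choice s = 0 gives the
  time-one map and s = 1 its inverse.\<close>

lemma flow_continuous_on:
  assumes X: "subordinate_field S \<rho> X" and s: "s \<in> {0..1}" and t: "t \<in> {0..1}"
    and G: "\<And>x. x \<in> W \<Longrightarrow> integral_curve X \<rho> (G x) \<and> G x s = x"
  shows "continuous_on W (\<lambda>x. G x t)"
proof (rule continuous_on_iff[THEN iffD2], intro ballI allI impI)
  fix x and e :: real assume x: "x \<in> W" and e: "0 < e"
  have S: "closed S" "0 \<in> S" using X by (auto simp: subordinate_field_def)
  have close: "norm (G y t - y) \<le> infdist y S / 3" if "y \<in> W" for y
    using integral_curve_dist_le[OF X _ t s, of "G y"] G[OF that] by simp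
  show "\<exists>d>0. \<forall>y\<in>W. dist y x < d \<longrightarrow> dist (G y t) (G x t) < e"
  proof (cases "x \<in> S")
    case True
    \<comment> \<open>The total is at most 4/3 |y - x|, and 4/3 * e/2 < e.\<close>
    have "dist (G y t) (G x t) < e" if y: "y \<in> W" "dist y x < e / 2" for y
    proof -
      have "G x t = x" using close[OF x] True by simp
      moreover have "norm (G y t - x) \<le> norm (G y t - y) + norm (y - x)"
        by (metis norm_diff_triangle_ineq diff_add_cancel norm_diff_triangle_le order_refl)
      moreover have "infdist y S \<le> norm (y - x)" using infdist_le[OF True, of y] by (simp add: dist_norm)
      ultimately show ?thesis using close[OF y(1)] y(2) e by (simp add: dist_norm)
    qed
    then show ?thesis using e by (intro exI[of _ "e / 2"]) auto
  next
    case False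
    define d where "d = infdist x S / 2"
    have "0 < d" using infdist_pos_not_in_closed[of S x] S False by (auto simp: d_def)
    obtain C where C: "C \<ge> 0" "\<And>\<gamma> \<beta>. integral_curve X \<rho> \<gamma> \<Longrightarrow> integral_curve X \<rho> \<beta> \<Longrightarrow>
        d \<le> infdist (\<gamma> s) S \<Longrightarrow> d \<le> infdist (\<beta> s) S \<Longrightarrow> norm (\<gamma> t - \<beta> t) \<le> C * norm (\<gamma> s - \<beta> s)"
      using integral_curves_lipschitz[OF X \<open>0 < d\<close>] s t by blast
    have "dist (G y t) (G x t) < e" if y: "y \<in> W" "dist y x < min d (e / (C + 1))" for y
    proof -
      have "d \<le> infdist y S" using infdist_triangle[of x S y] y(2) by (simp add: d_def dist_commute)
      moreover have "d \<le> infdist x S" using \<open>0 < d\<close> by (simp add: d_def)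
      ultimately have "norm (G y t - G x t) \<le> C * norm (y - x)"
        using C(2)[of "G y" "G x"] G[OF y(1)] G[OF x] by simp
      also have "\<dots> \<le> (C + 1) * dist y x" by (simp add: dist_norm mult_right_mono)
      also have "\<dots> < e" using y(2) C(1) by (simp add: field_simps)
      finally show ?thesis by (simp add: dist_norm)
    qed
    then show ?thesis using \<open>0 < d\<close> C(1) e by (intro exI[of _ "min d (e / (C + 1))"]) auto
  qed
qed

text \<open>Curves are constructed only from the ball of radius 3/4 \<rho>, so \<phi> and \<psi> are
  shown to cancel only where a point and its image both lie in it. The curves appear in the
  conclusion because preservation of the zero sets is proved along them.\<close>

lemma subordinate_field_homeomorphism:
  assumes X: "subordinate_field S \<rho> X"
  obtains U V \<phi> \<psi> where "open U" "open V" "0 \<in> U" "0 \<in> V" "homeomorphism U V \<phi> \<psi>"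
    "\<And>x. x \<in> U \<inter> S \<Longrightarrow> \<phi> x = x"
    "\<And>x. x \<in> U \<Longrightarrow> \<exists>\<gamma>. integral_curve X \<rho> \<gamma> \<and> \<gamma> 0 = x \<and> \<gamma> 1 = \<phi> x"
proof -
  have S: "closed S" "0 \<in> S" and \<rho>: "0 < \<rho>" using X by (auto simp: subordinate_field_def)
  let ?W = "ball (0::'a) (3 / 4 * \<rho>)"
  have "\<forall>x\<in>?W. \<exists>\<gamma>. integral_curve X \<rho> \<gamma> \<and> \<gamma> 0 = x" using integral_curve_exists[OF X] by auto
  then obtain G where G: "\<And>x. x \<in> ?W \<Longrightarrow> integral_curve X \<rho> (G x) \<and> G x 0 = x" by metis
  have "\<forall>x\<in>?W. \<exists>\<gamma>. integral_curve X \<rho> \<gamma> \<and> \<gamma> 1 = x" using integral_curve_exists_terminal[OF X] by auto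
  then obtain H where H: "\<And>x. x \<in> ?W \<Longrightarrow> integral_curve X \<rho> (H x) \<and> H x 1 = x" by metis
  define \<phi> where "\<phi> = (\<lambda>x. G x 1)"
  define \<psi> where "\<psi> = (\<lambda>x. H x 0)"
  have c\<phi>: "continuous_on ?W \<phi>" unfolding \<phi>_def by (rule flow_continuous_on[OF X _ _ G]) auto
  have c\<psi>: "continuous_on ?W \<psi>" unfolding \<psi>_def by (rule flow_continuous_on[OF X _ _ H]) auto
  have \<phi>_near: "norm (\<phi> x - x) \<le> infdist x S / 3" if "x \<in> ?W" for x
    using integral_curve_dist_le[OF X, of "G x" 1 0] G[OF that] by (simp add: \<phi>_def)
  have \<psi>_near: "norm (\<psi> x - x) \<le> infdist x S / 3" if "x \<in> ?W" for x
    using integral_curve_dist_le[OF X, of "H x" 0 1] H[OF that] by (simp add: \<psi>_def)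
  have \<psi>\<phi>: "\<psi> (\<phi> x) = x" if "x \<in> ?W" "\<phi> x \<in> ?W" for x
    using integral_curve_unique[OF X, of "H (\<phi> x)" "G x" 1 0] G[OF that(1)] H[OF that(2)]
    by (simp add: \<phi>_def \<psi>_def)
  have \<phi>\<psi>: "\<phi> (\<psi> x) = x" if "x \<in> ?W" "\<psi> x \<in> ?W" for x
    using integral_curve_unique[OF X, of "G (\<psi> x)" "H x" 0 1] H[OF that(1)] G[OF that(2)]
    by (simp add: \<phi>_def \<psi>_def)
  \<comment> \<open>A point moves by at most a third of its norm, and 4/3 * 1/2 = 2/3 < 3/4, so the
    image of U stays in \<open>?W\<close>.\<close>
  define U where "U = ball (0::'a) (\<rho> / 2)"
  \<comment> \<open>As a preimage under the continuous map \<psi> this set is open without an appeal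
    to invariance of domain.\<close>
  define V where "V = ?W \<inter> \<psi> -` U"
  have UW: "U \<subseteq> ?W" using \<rho> by (auto simp: U_def)
  have \<phi>W: "\<phi> x \<in> ?W" if "x \<in> U" for x
  proof -
    have "x \<in> ?W" using that UW by blast
    then have "norm (\<phi> x - x) \<le> norm x / 3" using \<phi>_near[of x] infdist_le_norm[OF S(2), of x] by simp
    moreover have "norm (\<phi> x) \<le> norm x + norm (\<phi> x - x)" by (rule norm_triangle_sub)
    moreover have "norm x < \<rho> / 2" using that by (simp add: U_def)
    ultimately show ?thesis using \<rho> by simp
  qed
  show thesis
  proof
    show "open U" "0 \<in> U" using \<rho> by (auto simp: U_def)
    show "open V" unfolding V_def by (rule continuous_open_preimage[OF c\<psi>]) (auto simp: U_def)
    have "\<psi> 0 = 0" using \<psi>_near[of 0] S \<rho> by simp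
    then show "0 \<in> V" using \<rho> by (simp add: V_def U_def)
    show "homeomorphism U V \<phi> \<psi>"
    proof (rule homeomorphismI)
      show "continuous_on U \<phi>" using c\<phi> UW continuous_on_subset by blast
      show "continuous_on V \<psi>" unfolding V_def using c\<psi> by (rule continuous_on_subset) auto
      show "\<phi> ` U \<subseteq> V" using UW \<phi>W \<psi>\<phi> by (fastforce simp: V_def)
      show "\<psi> ` V \<subseteq> U" by (auto simp: V_def)
      show "\<psi> (\<phi> x) = x" if "x \<in> U" for x using \<psi>\<phi> \<phi>W UW that by blast
      show "\<phi> (\<psi> x) = x" if "x \<in> V" for x using \<phi>\<psi>[of x] UW that by (auto simp: V_def)
    qed
    show "\<phi> x = x" if "x \<in> U \<inter> S" for x using \<phi>_near[of x] that UW by auto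
    show "\<exists>\<gamma>. integral_curve X \<rho> \<gamma> \<and> \<gamma> 0 = x \<and> \<gamma> 1 = \<phi> x" if "x \<in> U" for x
      using G[of x] that UW unfolding \<phi>_def by blast
  qed
qed

section \<open>Jacobians and the regularised Gram matrix\<close>

declare transpose_matrix_vector [simp del]

definition jac :: "(real^'n \<Rightarrow> real^'p) \<Rightarrow> real^'n \<Rightarrow> real^'n^'p" where
  "jac f x = (\<chi> j. grad (\<lambda>y. f y $ j) x)"

lemma jac_nth: "jac f x $ j $ i = hpd [i] (\<lambda>y. f y $ j) x"
  by (simp add: jac_def grad_def)

lemma transpose_mult_eq_sum: "transpose A *v w = (\<Sum>j\<in>UNIV. w $ j *\<^sub>R A $ j)"
  for A :: "real^'n^'p"
  by (simp add: vec_eq_iff matrix_vector_mult_def transpose_def mult.commute)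

lemma norm_transpose_mult_le: "norm (transpose A *v w) \<le> real CARD('p) * norm A * norm w"
  for A :: "real^'n^'p"
proof -
  have "norm (transpose A *v w) \<le> (\<Sum>j\<in>UNIV. norm (w $ j *\<^sub>R A $ j))"
    unfolding transpose_mult_eq_sum by (rule norm_sum)
  also have "\<dots> \<le> (\<Sum>j\<in>(UNIV::'p set). norm w * norm A)"
    by (intro sum_mono) (auto intro!: mult_mono component_le_norm_cart Finite_Cartesian_Product.norm_nth_le)
  finally show ?thesis by (simp add: mult.commute mult.left_commute)
qed

text \<open>If w_i is nonzero, dividing the combination of the gradients by w_i displays the i-th
  gradient minus an element of the span of the others, whose norm is at least \<open>kappa\<close>.
  So \<open>kappa\<close> bounds the smallest singular value of the transposed Jacobian from below,
  up to the factor p.\<close>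

lemma kappa_mult_le:
  fixes f :: "real^'n \<Rightarrow> real^'p"
  shows "kappa f x * norm w \<le> real CARD('p) * norm (transpose (jac f x) *v w)"
proof -
  define a where "a = (\<lambda>j. grad (\<lambda>y. f y $ j) x)"
  have tr: "transpose (jac f x) *v w = (\<Sum>j\<in>UNIV. w $ j *\<^sub>R a j)"
    by (simp add: transpose_mult_eq_sum jac_def a_def)
  have "0 \<le> kappa f x" unfolding kappa_def by (auto simp: infdist_nonneg)
  have comp: "kappa f x * \<bar>w $ i\<bar> \<le> norm (transpose (jac f x) *v w)" for i
  proof (cases "w $ i = 0")
    case False
    let ?b = "\<Sum>j\<in>UNIV - {i}. (- (w $ j / w $ i)) *\<^sub>R a j"
    have "kappa f x \<le> infdist (a i) (span (a ` (UNIV - {i})))"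
      unfolding kappa_def a_def by (intro Min_le) auto
    also have "\<dots> \<le> dist (a i) ?b"
      by (intro infdist_le span_sum span_scale span_base) auto
    finally have "kappa f x * \<bar>w $ i\<bar> \<le> norm (a i - ?b) * \<bar>w $ i\<bar>"
      by (simp add: dist_norm mult_right_mono)
    also have "\<dots> = norm (w $ i *\<^sub>R (a i - ?b))" by simp
    also have "w $ i *\<^sub>R (a i - ?b) = w $ i *\<^sub>R a i + (\<Sum>j\<in>UNIV - {i}. w $ j *\<^sub>R a j)"
      using False by (simp add: scaleR_right_distrib scaleR_sum_right sum_negf)
    also have "\<dots> = transpose (jac f x) *v w"
      unfolding tr by (subst sum.remove[of UNIV i]) auto
    finally show ?thesis .
  qed auto
  have "kappa f x * norm w \<le> kappa f x * (\<Sum>i\<in>UNIV. \<bar>w $ i\<bar>)"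
    using \<open>0 \<le> kappa f x\<close> by (intro mult_left_mono norm_le_l1_cart)
  also have "\<dots> \<le> (\<Sum>i\<in>(UNIV::'p set). norm (transpose (jac f x) *v w))"
    unfolding sum_distrib_left by (intro sum_mono comp)
  finally show ?thesis by simp
qed

lemma bounded_bilinear_matrix_vector_mult: "bounded_bilinear ((*v) :: real^'k^'m \<Rightarrow> real^'k \<Rightarrow> real^'m)"
  unfolding bilinear_conv_bounded_bilinear[symmetric] bilinear_def
  by (auto intro!: linearI simp: matrix_vector_right_distrib matrix_vector_mult_add_rdistrib
      matrix_vector_mult_scaleR scaleR_matrix_vector_assoc)

text \<open>The matrix M of the overview, a Gram matrix with a Tikhonov term; \<open>s\<close>
  stands for |F|^2.\<close>

definition regularised_gram :: "real \<Rightarrow> real \<Rightarrow> real^'n^'p \<Rightarrow> real^'p^'p" where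
  "regularised_gram d s A = d\<^sup>2 *\<^sub>R (A ** transpose A) + s *\<^sub>R mat 1"

lemma regularised_gram_mult:
  "regularised_gram d s A *v w = d\<^sup>2 *\<^sub>R (A *v (transpose A *v w)) + s *\<^sub>R w"
  by (simp add: regularised_gram_def matrix_vector_mult_add_rdistrib scaleR_matrix_vector_assoc[symmetric]
      matrix_vector_mul_assoc[symmetric])

lemma regularised_gram_inner:
  "w \<bullet> (regularised_gram d (q\<^sup>2) A *v w) = (d * norm (transpose A *v w))\<^sup>2 + (q * norm w)\<^sup>2"
  by (simp add: regularised_gram_mult inner_add_right dot_lmul_matrix[symmetric]
      transpose_matrix_vector power_mult_distrib power2_norm_eq_inner)

context
  fixes A :: "real^'n^'p" and d q m :: real
  assumes m: "0 < m" and lower: "\<And>w. m * norm w \<le> d * norm (transpose A *v w) + q * norm w"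
begin

text \<open>In the application d is the distance to S, q is |F| and m a multiple of d^r. The factor
  1/2 comes from (a + b)^2 \<le> 2 (a^2 + b^2).\<close>

lemma regularised_gram_inner_ge: "m\<^sup>2 / 2 * (norm w)\<^sup>2 \<le> w \<bullet> (regularised_gram d (q\<^sup>2) A *v w)"
proof -
  have sq: "(a + b)\<^sup>2 \<le> 2 * (a\<^sup>2 + b\<^sup>2)" for a b :: real
    using sum_squares_bound[of a b] by (simp add: power2_sum)
  have "(m * norm w)\<^sup>2 \<le> (d * norm (transpose A *v w) + q * norm w)\<^sup>2"
    using lower m by (intro power_mono) auto
  also note sq
  finally show ?thesis by (simp add: regularised_gram_inner power_mult_distrib)
qed

lemma regularised_gram_norm_ge: "m\<^sup>2 / 2 * norm w \<le> norm (regularised_gram d (q\<^sup>2) A *v w)"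
proof (cases "w = 0")
  case False
  have "m\<^sup>2 / 2 * (norm w)\<^sup>2 \<le> norm w * norm (regularised_gram d (q\<^sup>2) A *v w)"
    using regularised_gram_inner_ge[of w] norm_cauchy_schwarz order_trans by blast
  then have "norm w * (m\<^sup>2 / 2 * norm w) \<le> norm w * norm (regularised_gram d (q\<^sup>2) A *v w)"
    by (simp add: power2_eq_square mult.commute mult.left_commute)
  then show ?thesis by (rule mult_left_le_imp_le) (use False in simp)
qed simp

lemma regularised_gram_solvable: "\<exists>w. regularised_gram d (q\<^sup>2) A *v w = v"
proof -
  have "inj ((*v) (regularised_gram d (q\<^sup>2) A))"
  proof (rule linear_injective_0[OF matrix_vector_mul_linear, THEN iffD2], intro allI impI)
    fix w assume "regularised_gram d (q\<^sup>2) A *v w = 0"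
    then have "m\<^sup>2 / 2 * norm w \<le> 0" using regularised_gram_norm_ge[of w] by simp
    then show "w = 0" using m by (simp add: mult_le_0_iff)
  qed
  then have "surj ((*v) (regularised_gram d (q\<^sup>2) A))"
    by (rule linear_injective_imp_surjective[OF matrix_vector_mul_linear]) simp
  then show ?thesis by (metis surjD)
qed

text \<open>The energy E = w . v satisfies E^2 \<le> |w|^2 |v|^2 \<le> (2 E / m^2) |v|^2 by
  coercivity, hence E \<le> 2 |v|^2 / m^2, and E dominates the square of the left-hand side. Only
  one power of m is lost, which is what makes the field comparable to the distance.\<close>

lemma regularised_gram_solution_bound:
  assumes "regularised_gram d (q\<^sup>2) A *v w = v"
  shows "d * norm (transpose A *v w) \<le> 2 * norm v / m"
proof -
  define E where "E = w \<bullet> v"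
  have E: "E = (d * norm (transpose A *v w))\<^sup>2 + (q * norm w)\<^sup>2"
    using regularised_gram_inner[of w d q A] assms by (simp add: E_def)
  have "E * E \<le> (norm w * norm v) * (norm w * norm v)"
    using norm_cauchy_schwarz[of w v] E by (intro mult_mono) (auto simp: E_def)
  also have "\<dots> = (m\<^sup>2 / 2 * (norm w)\<^sup>2) * (2 * (norm v)\<^sup>2 / m\<^sup>2)"
    using m by (simp add: field_simps power2_eq_square)
  also have "\<dots> \<le> E * (2 * (norm v)\<^sup>2 / m\<^sup>2)"
    using regularised_gram_inner_ge[of w] assms by (intro mult_right_mono) (auto simp: E_def)
  finally have "E * E \<le> E * (2 * (norm v)\<^sup>2 / m\<^sup>2)" .
  moreover have "0 \<le> E" by (simp add: E)
  ultimately have "E \<le> 2 * (norm v)\<^sup>2 / m\<^sup>2"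
    by (cases "E = 0") (auto intro: mult_left_le_imp_le[of E])
  then have "(d * norm (transpose A *v w))\<^sup>2 \<le> 2 * (norm v)\<^sup>2 / m\<^sup>2"
    using E zero_le_power2[of "q * norm w"] by linarith
  \<comment> \<open>The square root of 2 is rounded up to 2.\<close>
  also have "\<dots> \<le> (2 * norm v / m)\<^sup>2"
    by (simp add: power_divide power_mult_distrib divide_right_mono)
  finally show ?thesis by (rule power2_le_imp_le) (use m in auto)
qed

end

section \<open>Lipschitz calculus with unspecified constants\<close>

lemma lipschitz_on_compact_bounded:
  fixes u :: "'z::metric_space \<Rightarrow> 'c::real_normed_vector"
  assumes "C-lipschitz_on K u" "compact K"
  shows "\<exists>b>0. \<forall>z\<in>K. norm (u z) \<le> b"
  using compact_imp_bounded[OF compact_continuous_image[OF lipschitz_on_continuous_on[OF assms(1)] assms(2)]]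
  unfolding bounded_pos by auto

text \<open>The product rule for Lipschitz maps: compactness bounds both factors. The constants are
  hidden under existential quantifiers so that these rules can be chained by
  \<open>intro\<close>.\<close>

lemma lipschitz_bounded_bilinear:
  fixes f :: "'z::metric_space \<Rightarrow> 'a::real_normed_vector" and g :: "'z \<Rightarrow> 'b::real_normed_vector"
  assumes "bounded_bilinear B" "compact K" "\<exists>L. L-lipschitz_on K f" "\<exists>L. L-lipschitz_on K g"
  shows "\<exists>L. L-lipschitz_on K (\<lambda>z. B (f z) (g z))"
proof -
  interpret bounded_bilinear B by fact
  obtain L M where L: "L-lipschitz_on K f" and M: "M-lipschitz_on K g" using assms by blast
  obtain b where b: "b > 0" "\<And>z. z \<in> K \<Longrightarrow> norm (f z) \<le> b" using lipschitz_on_compact_bounded[OF L \<open>compact K\<close>] by blast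
  obtain b' where b': "b' > 0" "\<And>z. z \<in> K \<Longrightarrow> norm (g z) \<le> b'" using lipschitz_on_compact_bounded[OF M \<open>compact K\<close>] by blast
  obtain k where k: "k > 0" "\<And>a a'. norm (B a a') \<le> norm a * norm a' * k" using pos_bounded by blast
  have "(L * b' * k + b * M * k)-lipschitz_on K (\<lambda>z. B (f z) (g z))"
  proof (rule lipschitz_onI)
    fix x y assume xy: "x \<in> K" "y \<in> K"
    have "B (f x) (g x) - B (f y) (g y) = B (f x - f y) (g x) + B (f y) (g x - g y)"
      by (simp add: diff_left diff_right)
    then have "dist (B (f x) (g x)) (B (f y) (g y)) \<le> norm (f x - f y) * norm (g x) * k + norm (f y) * norm (g x - g y) * k"
      unfolding dist_norm by (metis add_mono k(2) norm_triangle_le)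
    also have "\<dots> \<le> (L * dist x y) * b' * k + b * (M * dist x y) * k"
      using lipschitz_onD[OF L xy] lipschitz_onD[OF M xy] b b' xy k(1) lipschitz_on_nonneg[OF L] lipschitz_on_nonneg[OF M]
      by (intro add_mono mult_mono) (auto simp: dist_norm)
    finally show "dist (B (f x) (g x)) (B (f y) (g y)) \<le> (L * b' * k + b * M * k) * dist x y"
      by (simp add: algebra_simps)
  qed (use b b' k lipschitz_on_nonneg[OF L] lipschitz_on_nonneg[OF M] in simp)
  then show ?thesis ..
qed

lemma lipschitz_vec:
  fixes f :: "'z::metric_space \<Rightarrow> 'a::real_normed_vector^'m"
  assumes "\<And>i. \<exists>L. L-lipschitz_on K (\<lambda>z. f z $ i)"
  shows "\<exists>L. L-lipschitz_on K f"
proof -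
  obtain L where L: "\<And>i. (L i)-lipschitz_on K (\<lambda>z. f z $ i)" using assms by metis
  have "(\<Sum>i\<in>UNIV. L i)-lipschitz_on K f"
  proof (rule lipschitz_onI)
    fix x y assume xy: "x \<in> K" "y \<in> K"
    have "dist (f x) (f y) \<le> (\<Sum>i\<in>UNIV. dist (f x $ i) (f y $ i))"
      unfolding dist_vec_def by (rule L2_set_le_sum) auto
    also have "\<dots> \<le> (\<Sum>i\<in>UNIV. L i * dist x y)"
      by (intro sum_mono lipschitz_onD[OF L] xy)
    finally show "dist (f x) (f y) \<le> (\<Sum>i\<in>UNIV. L i) * dist x y" by (simp add: sum_distrib_right)
  qed (intro sum_nonneg lipschitz_on_nonneg[OF L])
  then show ?thesis ..
qed

text \<open>From N x (w x - w y) = (v x - v y) - (N x - N y) w y and the uniform lower bound on N.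
  No inverse matrix appears, and nothing is assumed of \<open>w\<close> except that it solves the
  equation.\<close>

lemma lipschitz_linear_solution:
  fixes N :: "'z::metric_space \<Rightarrow> real^'m^'m" and v w :: "'z \<Rightarrow> real^'m"
  assumes "compact K" "\<exists>L. L-lipschitz_on K N" "\<exists>L. L-lipschitz_on K v" "0 < m"
    and lower: "\<And>z u. z \<in> K \<Longrightarrow> m * norm u \<le> norm (N z *v u)"
    and sol: "\<And>z. z \<in> K \<Longrightarrow> N z *v w z = v z"
  shows "\<exists>L. L-lipschitz_on K w"
proof -
  obtain L M where L: "L-lipschitz_on K N" and M: "M-lipschitz_on K v" using assms by blast
  obtain B where B: "B > 0" "\<And>z. z \<in> K \<Longrightarrow> norm (v z) \<le> B"
    using lipschitz_on_compact_bounded[OF M \<open>compact K\<close>] by blast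
  have mv: "norm (A *v u) \<le> real CARD('m) * norm A * norm u" for A :: "real^'m^'m" and u
  proof -
    have "norm (A *v u) \<le> (\<Sum>i\<in>UNIV. \<bar>A $ i \<bullet> u\<bar>)"
      using norm_le_l1_cart[of "A *v u"] by (simp add: matrix_vector_mul_component)
    also have "\<dots> \<le> (\<Sum>i\<in>(UNIV::'m set). norm A * norm u)"
      by (intro sum_mono order_trans[OF Cauchy_Schwarz_ineq2] mult_right_mono Finite_Cartesian_Product.norm_nth_le) auto
    finally show ?thesis by simp
  qed
  have w_bound: "norm (w z) \<le> B / m" if "z \<in> K" for z
    using lower[OF that, of "w z"] sol[OF that] B(2)[OF that] \<open>0 < m\<close> by (simp add: field_simps)
  have "((M + real CARD('m) * L * (B / m)) / m)-lipschitz_on K w"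
  proof (rule lipschitz_onI)
    fix x y assume xy: "x \<in> K" "y \<in> K"
    have "N x *v (w x - w y) = (v x - v y) - (N x - N y) *v w y"
      using sol xy by (simp add: matrix_vector_mult_diff_distrib matrix_vector_mult_diff_rdistrib)
    then have "m * norm (w x - w y) \<le> norm (v x - v y) + norm ((N x - N y) *v w y)"
      using lower[OF xy(1), of "w x - w y"] norm_triangle_ineq4 order_trans by metis
    also have "\<dots> \<le> M * dist x y + real CARD('m) * (L * dist x y) * (B / m)"
    proof (intro add_mono)
      show "norm (v x - v y) \<le> M * dist x y" using lipschitz_onD[OF M xy] by (simp add: dist_norm)
      have "norm ((N x - N y) *v w y) \<le> real CARD('m) * norm (N x - N y) * norm (w y)" by (rule mv)
      also have "\<dots> \<le> real CARD('m) * (L * dist x y) * (B / m)"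
        using lipschitz_onD[OF L xy] w_bound[OF xy(2)] lipschitz_on_nonneg[OF L]
        by (intro mult_mono) (auto simp: dist_norm)
      finally show "norm ((N x - N y) *v w y) \<le> real CARD('m) * (L * dist x y) * (B / m)" .
    qed
    finally show "dist (w x) (w y) \<le> (M + real CARD('m) * L * (B / m)) / m * dist x y"
      using \<open>0 < m\<close> by (simp add: dist_norm field_simps)
  qed (use \<open>0 < m\<close> B lipschitz_on_nonneg[OF L] lipschitz_on_nonneg[OF M] in simp)
  then show ?thesis ..
qed

text \<open>The partials of the next order are bounded on the compact convex ball. For the entries
  of a Jacobian the length is 1, so the rule needs r \<ge> 2; hence the separate treatment of r =
  1.\<close>

lemma Ck_lipschitz:
  fixes g :: "real^'n \<Rightarrow> real"
  assumes g: "Ck r U g" "open U" "cball 0 \<rho> \<subseteq> U" "length is < r"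
  shows "\<exists>L. L-lipschitz_on (cball 0 \<rho>) (hpd is g)"
proof -
  have "\<exists>B\<ge>0. \<forall>x\<in>cball 0 \<rho>. \<bar>hpd (i # is) g x\<bar> \<le> B" for i
  proof -
    have "continuous_on (cball 0 \<rho>) (hpd (i # is) g)"
      using Ck_continuous[OF g(1), of "i # is"] g continuous_on_subset by auto
    then have "bounded (hpd (i # is) g ` cball 0 \<rho>)"
      by (intro compact_imp_bounded compact_continuous_image) auto
    then show ?thesis unfolding bounded_pos by (auto intro: less_imp_le)
  qed
  then obtain B where B: "\<And>i. B i \<ge> 0" "\<And>i x. x \<in> cball 0 \<rho> \<Longrightarrow> \<bar>hpd (i # is) g x\<bar> \<le> B i" by metis
  have "(\<Sum>i\<in>UNIV. B i)-lipschitz_on (cball 0 \<rho>) (hpd is g)"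
  proof (rule bounded_derivative_imp_lipschitz)
    fix x :: "real^'n" assume x: "x \<in> cball 0 \<rho>"
    then have "x \<in> U" using g by blast
    then show "(hpd is g has_derivative (\<lambda>h. \<Sum>i\<in>UNIV. h $ i * hpd (i # is) g x)) (at x within cball 0 \<rho>)"
      by (rule has_derivative_at_withinI[OF Ck_has_derivative[OF g(1,2) _ g(4)]])
    show "onorm (\<lambda>h. \<Sum>i\<in>UNIV. h $ i * hpd (i # is) g x) \<le> (\<Sum>i\<in>UNIV. B i)"
    proof (rule onorm_bound)
      fix h
      have "norm (\<Sum>i\<in>UNIV. h $ i * hpd (i # is) g x) \<le> (\<Sum>i\<in>UNIV. norm h * B i)"
        using B x by (intro sum_norm_le) (auto simp: abs_mult intro!: mult_mono component_le_norm_cart)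
      then show "norm (\<Sum>i\<in>UNIV. h $ i * hpd (i # is) g x) \<le> (\<Sum>i\<in>UNIV. B i) * norm h"
        by (simp add: sum_distrib_left mult.commute)
    qed (simp add: B sum_nonneg)
  qed (auto simp: B sum_nonneg)
  then show ?thesis ..
qed

section \<open>Differentials and flatness of vector-valued germs\<close>

lemma jac_has_derivative:
  fixes f :: "real^'n \<Rightarrow> real^'p"
  assumes f: "\<And>j. Ck r U (\<lambda>x. f x $ j)" and "open U" "x \<in> U" "1 \<le> r"
  shows "(f has_derivative (\<lambda>h. jac f x *v h)) (at x)"
proof -
  have "((\<lambda>y. f y \<bullet> b) has_derivative (\<lambda>h. (jac f x *v h) \<bullet> b)) (at x)" if "b \<in> Basis" for b
  proof -
    obtain j where j: "b = axis j 1" using \<open>b \<in> Basis\<close> by (auto simp: Basis_vec_def)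
    have "((\<lambda>y. f y $ j) has_derivative (\<lambda>h. (jac f x *v h) $ j)) (at x)"
      using Ck_has_derivative[OF f assms(2,3), of "[]" j] assms(4)
      by (simp add: matrix_vector_mult_def jac_nth mult.commute)
    then show ?thesis by (simp add: j inner_axis)
  qed
  then show ?thesis by (subst has_derivative_componentwise_within) blast
qed

lemma germs_flat:
  fixes f g :: "real^'n \<Rightarrow> real^'p"
  assumes f: "germ_Cr r f" and g: "germ_Cr r g" and jet: "rel_jet_eq r S g f"
    and S: "closed S" "0 \<in> S" and "1 \<le> r" and "0 < \<epsilon>"
  shows "\<forall>\<^sub>F x in nhds 0. norm (g x - f x) \<le> \<epsilon> * infdist x S ^ r \<and>
      norm (jac g x - jac f x) \<le> \<epsilon> * infdist x S ^ (r - 1)"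
proof -
  obtain Uf Ug Uj where U: "open Uf" "0 \<in> Uf" "\<And>j. Ck r Uf (\<lambda>x. f x $ j)"
    "open Ug" "0 \<in> Ug" "\<And>j. Ck r Ug (\<lambda>x. g x $ j)" "open Uj" "0 \<in> Uj"
    "\<And>x is j. x \<in> S \<inter> Uj \<Longrightarrow> length is \<le> r \<Longrightarrow> hpd is (\<lambda>y. g y $ j) x = hpd is (\<lambda>y. f y $ j) x"
    using f g jet unfolding germ_Cr_def rel_jet_eq_def by metis
  define U where "U = Uf \<inter> Ug \<inter> Uj"
  have ev: "\<forall>\<^sub>F x in nhds 0. \<bar>hpd is (\<lambda>y. g y $ j) x - hpd is (\<lambda>y. f y $ j) x\<bar> \<le> \<eta> * infdist x S ^ (r - length is)"
    if "length is \<le> r" "0 < \<eta>" for "is" :: "'n list" and j \<eta>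
  proof -
    have "\<exists>\<delta>>0. \<forall>x\<in>cball 0 \<delta>. \<bar>hpd is (\<lambda>y. g y $ j) x - hpd is (\<lambda>y. f y $ j) x\<bar> \<le> \<eta> * infdist x S ^ (r - length is)"
      by (rule jets_agree_imp_flat[of U])
        (use U S that in \<open>auto simp: U_def intro: Ck_subset[of r Uf] Ck_subset[of r Ug]\<close>)
    then show ?thesis unfolding eventually_nhds_metric by (force simp: dist_commute)
  qed
  define P where "P = real CARD('p)"
  define N where "N = real CARD('n)"
  have "P > 0" "N > 0" by (auto simp: P_def N_def)
  have "\<forall>\<^sub>F x in nhds 0. \<forall>j. \<bar>g x $ j - f x $ j\<bar> \<le> \<epsilon> / P * infdist x S ^ r"
    using ev[of "[]" "\<epsilon> / P"] \<open>0 < \<epsilon>\<close> \<open>P > 0\<close> by (intro eventually_all_finite) simp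
  moreover have "\<forall>\<^sub>F x in nhds 0. \<forall>j i. \<bar>jac g x $ j $ i - jac f x $ j $ i\<bar> \<le> \<epsilon> / (P * N) * infdist x S ^ (r - 1)"
    unfolding jac_nth using ev[of "[_]" "\<epsilon> / (P * N)"] \<open>0 < \<epsilon>\<close> \<open>P > 0\<close> \<open>N > 0\<close> \<open>1 \<le> r\<close>
    by (intro eventually_all_finite) (auto simp del: hpd.simps)
  ultimately show ?thesis
  proof eventually_elim
    case (elim x)
    have "norm (g x - f x) \<le> (\<Sum>j\<in>UNIV. \<bar>(g x - f x) $ j\<bar>)" by (rule norm_le_l1_cart)
    also have "\<dots> \<le> (\<Sum>j\<in>(UNIV::'p set). \<epsilon> / P * infdist x S ^ r)" using elim(1) by (intro sum_mono) auto
    also have "\<dots> = \<epsilon> * infdist x S ^ r" using \<open>P > 0\<close> by (simp add: P_def)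
    finally have 1: "norm (g x - f x) \<le> \<epsilon> * infdist x S ^ r" .
    have "norm (jac g x - jac f x) \<le> (\<Sum>j\<in>UNIV. norm ((jac g x - jac f x) $ j))"
      unfolding norm_vec_def[of "jac g x - jac f x"] by (rule L2_set_le_sum) auto
    also have "\<dots> \<le> (\<Sum>j\<in>(UNIV::'p set). \<Sum>i\<in>(UNIV::'n set). \<epsilon> / (P * N) * infdist x S ^ (r - 1))"
      using elim(2) by (intro sum_mono order_trans[OF norm_le_l1_cart] sum_mono) auto
    also have "\<dots> = \<epsilon> * infdist x S ^ (r - 1)" using \<open>P > 0\<close> \<open>N > 0\<close> by (simp add: P_def N_def)
    finally show ?case using 1 by simp
  qed
qed

lemma homeomorphism_zero_sets:
  assumes "homeomorphism U V \<phi> \<psi>" and "\<And>x. x \<in> U \<Longrightarrow> g x = 0 \<longleftrightarrow> h (\<phi> x) = 0"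
  shows "homeomorphism {x\<in>U. g x = 0} {x\<in>V. h x = 0} \<phi> \<psi>"
proof (rule homeomorphism_of_subsets[OF assms(1)])
  show "\<phi> ` {x\<in>U. g x = 0} = {x\<in>V. h x = 0}"
    using assms unfolding homeomorphism_def by force
qed auto

section \<open>Order one\<close>

lemma jac_continuous_on:
  fixes f :: "real^'n \<Rightarrow> real^'p"
  assumes "\<And>j. Ck r U (\<lambda>x. f x $ j)" "1 \<le> r"
  shows "continuous_on U (jac f)"
proof -
  have "continuous_on U (\<lambda>x. \<chi> j. \<chi> i. hpd [i] (\<lambda>y. f y $ j) x)"
    by (intro continuous_on_vec_lambda Ck_continuous[OF assms(1)]) (use assms(2) in simp)
  then show ?thesis by (simp add: jac_def[abs_def] grad_def[abs_def])
qed

text \<open>Adding to the identity a right inverse B of the differential A at 0, applied to the nonlinear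
  part of q, gives a local homeomorphism Q with A Q = q.\<close>

lemma submersion_straightening:
  fixes q :: "real^'n \<Rightarrow> real^'p" and B :: "real^'p^'n"
  assumes q: "\<And>j. Ck r U (\<lambda>x. q x $ j)" "1 \<le> r" and U: "open U" "0 \<in> U" and q0: "q 0 = 0"
    and A: "jac q 0 = A"
  obtains U' V' Q' where "open U'" "0 \<in> U'" "open V'" "0 \<in> V'"
    "homeomorphism U' V' (\<lambda>x. x + B *v (q x - A *v x)) Q'"
proof -
  define D where "D = (\<lambda>x h. h + B *v (jac q x *v h - A *v h))"
  have bl: "bounded_linear (D x)" for x
    unfolding D_def
    by (intro bounded_linear_add bounded_linear_ident bounded_linear_sub matrix_vector_mul_bounded_linear
        bounded_linear_compose[OF matrix_vector_mul_bounded_linear])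
  define D' where "D' = (\<lambda>x. Blinfun (D x))"
  have app: "blinfun_apply (D' x) = D x" for x unfolding D'_def by (rule bounded_linear_Blinfun_apply[OF bl])
  have der: "((\<lambda>x. x + B *v (q x - A *v x)) has_derivative blinfun_apply (D' x)) (at x)" if "x \<in> U" for x
    unfolding app D_def
    by (intro has_derivative_add has_derivative_ident has_derivative_diff jac_has_derivative[OF q(1) U(1) that q(2)]
        bounded_linear.has_derivative[OF matrix_vector_mul_bounded_linear])
  have cont: "continuous_on U D'"
  proof (rule continuous_on_blinfun_componentwise)
    fix i :: "real^'n"
    show "continuous_on U (\<lambda>x. blinfun_apply (D' x) i)"
      unfolding app D_def
      by (intro continuous_intros continuous_on_compose2[OF linear_continuous_on[OF matrix_vector_mul_bounded_linear[of B]]]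
          bounded_bilinear.continuous_on[OF bounded_bilinear_matrix_vector_mult] jac_continuous_on[OF q]) auto
  qed
  \<comment> \<open>The Jacobian of q at 0 is A, so the correction has vanishing differential there
    and the inverse function theorem applies with the identity as inverse.\<close>
  have "D' 0 = id_blinfun" by (rule blinfun_eqI) (simp add: app D_def A)
  then have inv: "id_blinfun o\<^sub>L D' 0 = id_blinfun" by (simp add: blinfun_eqI)
  show thesis
  proof (rule inverse_function_theorem[OF U(1) der cont U(2) inv])
    fix U' V' Q'
    assume "open U'" "0 \<in> U'" "open V'" "0 + B *v (q 0 - A *v 0) \<in> V'"
      "homeomorphism U' V' (\<lambda>x. x + B *v (q x - A *v x)) Q'"
    then show thesis using that q0 by simp
  qed
qed

lemma SV_equiv_of_submersions:
  fixes S :: "(real^'n) set" and g h :: "real^'n \<Rightarrow> real^'p"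
  assumes g: "germ_Cr r g" and h: "germ_Cr r h" and "1 \<le> r"
    and A: "jac g 0 = A" "jac h 0 = A" and inj: "\<And>w. transpose A *v w = 0 \<Longrightarrow> w = 0"
    and eq: "\<forall>\<^sub>F x in nhds 0. x \<in> S \<longrightarrow> g x = h x"
  shows "SV_equiv S g h"
proof -
  \<comment> \<open>Injectivity of the transpose of A is surjectivity of A: a left inverse of the
    former transposes into a right inverse of the latter.\<close>
  obtain C where "C ** transpose A = mat 1"
    using matrix_left_invertible_ker[of "transpose A"] inj by blast
  then have AB: "A ** transpose C = mat 1"
    by (metis matrix_transpose_mul transpose_mat transpose_transpose)
  define B where "B = transpose C"
  define G where "G = (\<lambda>x. x + B *v (g x - A *v x))"
  define H where "H = (\<lambda>x. x + B *v (h x - A *v x))"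
  have straight: "A *v (x + B *v (y - A *v x)) = y" for x y
    using AB by (simp add: B_def matrix_vector_right_distrib matrix_vector_mul_assoc)
  obtain Ug Uh where Ug: "open Ug" "0 \<in> Ug" "\<And>j. Ck r Ug (\<lambda>x. g x $ j)" "g 0 = 0"
    and Uh: "open Uh" "0 \<in> Uh" "\<And>j. Ck r Uh (\<lambda>x. h x $ j)" "h 0 = 0"
    using g h unfolding germ_Cr_def by metis
  obtain U1 V1 G' where G: "open U1" "0 \<in> U1" "open V1" "0 \<in> V1" "homeomorphism U1 V1 G G'"
    by (rule submersion_straightening[OF Ug(3) \<open>1 \<le> r\<close> Ug(1,2,4) A(1), of B, folded G_def])
  obtain U2 V2 H' where H: "open U2" "0 \<in> U2" "open V2" "0 \<in> V2" "homeomorphism U2 V2 H H'"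
    by (rule submersion_straightening[OF Uh(3) \<open>1 \<le> r\<close> Uh(1,2,4) A(2), of B, folded H_def])
  obtain W0 where W0: "open W0" "0 \<in> W0" "\<And>x. x \<in> W0 \<Longrightarrow> x \<in> S \<Longrightarrow> g x = h x"
    using eq unfolding eventually_nhds by blast
  define W where "W = U1 \<inter> U2 \<inter> W0"
  \<comment> \<open>A common target for both straightenings. The condition on \<open>G'\<close> puts
    every point of U into W; there points of S satisfy g = h, hence G = H, and lie in U2, so H'
    undoes H.\<close>
  define T where "T = (V1 \<inter> V2) \<inter> G' -` W"
  have cG: "continuous_on U1 G" "continuous_on V1 G'" "continuous_on U2 H"
    using G(5) H(5) by (auto simp: homeomorphism_def)
  have "open T" unfolding T_def
  proof (rule continuous_open_preimage)
    show "continuous_on (V1 \<inter> V2) G'" using cG(2) continuous_on_subset by blast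
  qed (use G H W0 in \<open>auto simp: W_def\<close>)
  define U where "U = U1 \<inter> G -` T"
  define V where "V = U2 \<inter> H -` T"
  have "open U" "open V" unfolding U_def V_def
    using cG G H \<open>open T\<close> by (auto intro: continuous_open_preimage)
  have G0: "G 0 = 0" "H 0 = 0" by (simp_all add: G_def H_def Ug Uh)
  have inv: "G' (G x) = x" "y \<in> U2 \<Longrightarrow> H' (H y) = y" "z \<in> V1 \<Longrightarrow> G (G' z) = z \<and> G' z \<in> U1"
      "z' \<in> V2 \<Longrightarrow> H (H' z') = z' \<and> H' z' \<in> U2" if "x \<in> U1" for x y z z'
    using G(5) H(5) that by (auto simp: homeomorphism_def)
  have "0 \<in> T" using inv(1)[OF G(2)] G H W0 G0 by (simp add: T_def W_def)
  then have "0 \<in> U" "0 \<in> V" using G H G0 by (auto simp: U_def V_def)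
  have GT: "homeomorphism U T G G'"
  proof (rule homeomorphism_of_subsets[OF G(5)])
    show "G ` U = T" using inv(3)[OF G(2)] by (force simp: U_def T_def)
  qed (auto simp: U_def T_def)
  have HT: "homeomorphism V T H H'"
  proof (rule homeomorphism_of_subsets[OF H(5)])
    show "H ` V = T" using inv(4)[OF G(2)] by (force simp: V_def T_def)
  qed (auto simp: V_def T_def)
  have hom: "homeomorphism U V (H' \<circ> G) (G' \<circ> H)"
    by (rule homeomorphism_compose[OF GT homeomorphism_symD[OF HT]])
  have "h ((H' \<circ> G) x) = g x" if "x \<in> U" for x
  proof -
    have "H (H' (G x)) = G x" using inv(4)[OF G(2), of "G x"] that by (simp add: U_def T_def)
    then have "A *v H (H' (G x)) = A *v G x" by simp
    then show ?thesis by (simp only: G_def H_def straight o_def)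
  qed
  then have "homeomorphism {x\<in>U. g x = 0} {x\<in>V. h x = 0} (H' \<circ> G) (G' \<circ> H)"
    by (intro homeomorphism_zero_sets[OF hom]) simp
  moreover have "(H' \<circ> G) x = x" if "x \<in> U" "x \<in> S" for x
  proof -
    have "x \<in> W" using that inv(1)[of x] by (auto simp: U_def T_def)
    then have "G x = H x" "x \<in> U2" using W0(3) that(2) by (auto simp: W_def G_def H_def)
    then show ?thesis using inv(2)[OF G(2), of x] by simp
  qed
  ultimately show ?thesis unfolding SV_equiv_def
    using \<open>open U\<close> \<open>open V\<close> \<open>0 \<in> U\<close> \<open>0 \<in> V\<close>
    by (intro exI[of _ U] exI[of _ V] exI[of _ "H' \<circ> G"] exI[of _ "G' \<circ> H"] conjI ballI) simp_all
qed

lemma SV_equiv_of_order_1: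
  fixes S :: "(real^'n) set" and f g h :: "real^'n \<Rightarrow> real^'p"
  assumes S: "closed S" "0 \<in> S"
    and f: "germ_Cr 1 f" and g: "germ_Cr 1 g" and h: "germ_Cr 1 h"
    and jets: "rel_jet_eq 1 S g f" "rel_jet_eq 1 S h f"
    and "0 < k"
    and cond: "\<forall>\<^sub>F x in nhds 0. infdist x S \<le> k * (infdist x S * kappa f x + norm (f x))"
  shows "SV_equiv S g h"
proof -
  have flat: "\<forall>\<^sub>F x in nhds 0. norm (g x - f x) \<le> \<epsilon> * infdist x S \<and> norm (h x - f x) \<le> \<epsilon> * infdist x S"
    if "0 < \<epsilon>" for \<epsilon>
    using germs_flat[OF f g jets(1) S order_refl that] germs_flat[OF f h jets(2) S order_refl that]
    by eventually_elim auto
  have eq: "\<forall>\<^sub>F x in nhds 0. x \<in> S \<longrightarrow> g x = f x \<and> h x = f x"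
    using flat[OF zero_less_one] by eventually_elim auto
  show ?thesis
  proof (cases "\<exists>w. w \<noteq> 0 \<and> transpose (jac f 0) *v w = 0")
    case False
    have jac0: "jac g 0 = jac f 0" "jac h 0 = jac f 0"
      using jets S unfolding rel_jet_eq_def by (auto simp: vec_eq_iff jac_nth simp del: hpd.simps)
    show ?thesis
      by (rule SV_equiv_of_submersions[OF g h order_refl jac0])
        (use False eq in \<open>auto elim: eventually_mono\<close>)
  next
    case True
    then obtain w where w: "w \<noteq> 0" "transpose (jac f 0) *v w = 0" by blast
    define p where "p = real CARD('p)"
    have "0 < p" by (simp add: p_def)
    \<comment> \<open>Chosen so that \<open>kappa f x\<close> \<le> p * p * \<eta> = 1 / (2 k) near
      0: one factor p comes from \<open>kappa_mult_le\<close>, the other from the norm of the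
      transposed matrix. The kernel vector w at 0 makes this possible by continuity of the
      Jacobian.\<close>
    define \<eta> where "\<eta> = 1 / (2 * k * p * p)"
    have "0 < \<eta>" using \<open>0 < p\<close> \<open>0 < k\<close> by (simp add: \<eta>_def)
    obtain Uf where Uf: "open Uf" "0 \<in> Uf" "\<And>j. Ck 1 Uf (\<lambda>x. f x $ j)"
      using f unfolding germ_Cr_def by blast
    have "isCont (jac f) 0"
      using jac_continuous_on[OF Uf(3)] Uf(1,2) continuous_on_eq_continuous_at by blast
    then have "(jac f \<longlongrightarrow> jac f 0) (nhds 0)" by (simp add: isCont_def tendsto_at_iff_tendsto_nhds)
    then have "\<forall>\<^sub>F x in nhds 0. dist (jac f x) (jac f 0) < \<eta>" using \<open>0 < \<eta>\<close> by (rule tendstoD)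
    \<comment> \<open>Absorbing the \<open>kappa\<close> term leaves d / 2 \<le> k |f|. At a zero of
      g or h flatness gives k |f| \<le> d / 4, which forces d = 0.\<close>
    moreover have "0 < 1 / (4 * k)" using \<open>0 < k\<close> by simp
    note flat[OF this]
    ultimately have "\<forall>\<^sub>F x in nhds 0. (g x = 0 \<longrightarrow> x \<in> S) \<and> (h x = 0 \<longrightarrow> x \<in> S) \<and> (x \<in> S \<longrightarrow> g x = h x)"
      using cond eq
    proof eventually_elim
      case (elim x)
      let ?d = "infdist x S"
      have "transpose (jac f x) *v w = transpose (jac f x - jac f 0) *v w"
        using w(2) by (simp add: transpose_mult_eq_sum scaleR_right_diff_distrib sum_subtractf)
      then have "norm (transpose (jac f x) *v w) \<le> p * norm (jac f x - jac f 0) * norm w"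
        using norm_transpose_mult_le[of "jac f x - jac f 0" w] by (simp add: p_def)
      also have "\<dots> \<le> p * \<eta> * norm w"
        using elim(1) \<open>0 < p\<close> by (intro mult_right_mono mult_left_mono) (auto simp: dist_norm)
      finally have "kappa f x * norm w \<le> p * (p * \<eta> * norm w)"
        using kappa_mult_le[of f x w] mult_left_mono[of _ "p * \<eta> * norm w" p] \<open>0 < p\<close>
        unfolding p_def by (meson less_imp_le order_trans)
      then have "kappa f x * norm w \<le> (p * p * \<eta>) * norm w" by (simp add: mult_ac)
      then have "kappa f x \<le> p * p * \<eta>" by (rule mult_right_le_imp_le) (use w in simp)
      also have "\<dots> = 1 / (2 * k)" using \<open>0 < p\<close> by (simp add: \<eta>_def field_simps)
      finally have "?d * kappa f x \<le> ?d * (1 / (2 * k))" by (intro mult_left_mono infdist_nonneg)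
      then have "k * (?d * kappa f x + norm (f x)) \<le> k * (?d * (1 / (2 * k)) + norm (f x))"
        using \<open>0 < k\<close> by (intro mult_left_mono) auto
      also have "\<dots> = ?d / 2 + k * norm (f x)" using \<open>0 < k\<close> by (simp add: field_simps)
      finally have fx: "?d / 2 \<le> k * norm (f x)" using elim(3) by linarith
      have inS: "x \<in> S" if "norm (f x) \<le> 1 / (4 * k) * ?d"
      proof -
        have "k * norm (f x) \<le> k * (1 / (4 * k) * ?d)" using that \<open>0 < k\<close> by (intro mult_left_mono) auto
        also have "\<dots> = ?d / 4" using \<open>0 < k\<close> by simp
        finally have "?d = 0" using fx infdist_nonneg[of x S] by linarith
        then show ?thesis using S in_closed_iff_infdist_zero[of S x] by auto
      qed
      then show ?case using elim(2,4) by auto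
    qed
    then obtain U where U: "open U" "0 \<in> U"
      "\<And>x. x \<in> U \<Longrightarrow> (g x = 0 \<longrightarrow> x \<in> S) \<and> (h x = 0 \<longrightarrow> x \<in> S) \<and> (x \<in> S \<longrightarrow> g x = h x)"
      unfolding eventually_nhds by blast
    \<comment> \<open>The zero sets coincide near 0, so the identity is the required
      homeomorphism.\<close>
    have "{x\<in>U. g x = 0} = {x\<in>U. h x = 0}" using U(3) by fastforce
    then have "homeomorphism {x\<in>U. g x = 0} {x\<in>U. h x = 0} (\<lambda>x. x) (\<lambda>x. x)"
      by (simp add: homeomorphism_ident)
    then show ?thesis unfolding SV_equiv_def using U(1,2) by blast
  qed
qed

section \<open>Higher order\<close>

lemma bounded_bilinear_matrix_mult: "bounded_bilinear ((**) :: real^'k^'m \<Rightarrow> real^'l^'k \<Rightarrow> real^'l^'m)"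
  unfolding bilinear_conv_bounded_bilinear[symmetric] bilinear_def
  by (auto intro!: linearI simp: matrix_matrix_mult_def vec_eq_iff algebra_simps sum.distrib sum_distrib_left)

lemma lipschitz_vec_iff: "(\<exists>L. L-lipschitz_on K f) \<longleftrightarrow> (\<forall>i. \<exists>L. L-lipschitz_on K (\<lambda>z. f z $ i))"
  for f :: "'z::metric_space \<Rightarrow> 'a::real_normed_vector^'m"
proof (intro iffI allI)
  fix i assume "\<exists>L. L-lipschitz_on K f"
  then obtain L where "L-lipschitz_on K f" ..
  then have "L-lipschitz_on K (\<lambda>z. f z $ i)"
    unfolding lipschitz_on_def using dist_vec_nth_le order_trans by blast
  then show "\<exists>L. L-lipschitz_on K (\<lambda>z. f z $ i)" ..
qed (simp add: lipschitz_vec)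

lemma lipschitz_compose_snd:
  "\<exists>L. L-lipschitz_on K u \<Longrightarrow> J \<subseteq> UNIV \<times> K \<Longrightarrow> \<exists>L. L-lipschitz_on J (\<lambda>z. u (snd z))"
proof -
  assume "\<exists>L. L-lipschitz_on K u" and J: "J \<subseteq> UNIV \<times> K"
  then obtain L where L: "L-lipschitz_on K u" by blast
  have "L-lipschitz_on J (\<lambda>z. u (snd z))"
  proof (rule lipschitz_onI)
    fix p q assume "p \<in> J" "q \<in> J"
    then have "dist (u (snd p)) (u (snd q)) \<le> L * dist (snd p) (snd q)"
      using J by (intro lipschitz_onD[OF L]) auto
    also have "\<dots> \<le> L * dist p q"
      by (intro mult_left_mono dist_snd_le lipschitz_on_nonneg[OF L])
    finally show "dist (u (snd p)) (u (snd q)) \<le> L * dist p q" .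
  qed (rule lipschitz_on_nonneg[OF L])
  then show ?thesis ..
qed

lemma lipschitz_exists_add:
  fixes f g :: "'z::metric_space \<Rightarrow> 'a::real_normed_vector"
  shows "\<exists>L. L-lipschitz_on K f \<Longrightarrow> \<exists>L. L-lipschitz_on K g \<Longrightarrow> \<exists>L. L-lipschitz_on K (\<lambda>z. f z + g z)"
  using lipschitz_on_add by blast

lemma lipschitz_exists_diff:
  fixes f g :: "'z::metric_space \<Rightarrow> 'a::real_normed_vector"
  shows "\<exists>L. L-lipschitz_on K f \<Longrightarrow> \<exists>L. L-lipschitz_on K g \<Longrightarrow> \<exists>L. L-lipschitz_on K (\<lambda>z. f z - g z)"
  using lipschitz_on_diff by blast

lemma norm_convex_combination_diff_le:
  fixes b c x :: "'v::real_normed_vector"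
  assumes "norm (b - x) \<le> B" "norm (c - x) \<le> B" "t \<in> {0..1}"
  shows "norm ((1 - t) *\<^sub>R b + t *\<^sub>R c - x) \<le> B"
  using convexD_alt[OF convex_cball, of b x B c t] assms by (simp add: dist_norm norm_minus_commute)

lemma SV_equiv_of_order_ge_2:
  fixes S :: "(real^'n) set" and f g h :: "real^'n \<Rightarrow> real^'p"
  assumes S: "closed S" "0 \<in> S" and r: "2 \<le> r"
    and f: "germ_Cr r f" and g: "germ_Cr r g" and h: "germ_Cr r h"
    and jets: "rel_jet_eq r S g f" "rel_jet_eq r S h f"
    and "0 < k"
    and cond: "\<forall>\<^sub>F x in nhds 0. infdist x S ^ r \<le> k * (infdist x S * kappa f x + norm (f x))"
  shows "SV_equiv S g h"
proof -
  define p where "p = real CARD('p)"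
  have p: "1 \<le> p" unfolding p_def using one_le_card_finite[where 'a='p] by simp
  \<comment> \<open>With p \<ge> 1 the hypothesis becomes a d^r \<le> d * kappa / p + |f|; the
    divisor p prepares for \<open>kappa_mult_le\<close>.\<close>
  define a where "a = 1 / (k * p)"
  have "0 < a" using p \<open>0 < k\<close> by (simp add: a_def)
  \<comment> \<open>The first bound lets half of a survive the passage from f to F; the second makes
    the speed factor 8 \<epsilon> / a at most 1/4.\<close>
  define \<epsilon> where "\<epsilon> = min (a / (2 * (p + 1))) (a / 32)"
  have "(p + 1) * \<epsilon> \<le> (p + 1) * (a / (2 * (p + 1)))"
    using p by (intro mult_left_mono) (auto simp: \<epsilon>_def)
  also have "\<dots> = a / 2" using p by (simp add: field_simps)
  finally have "(p + 1) * \<epsilon> \<le> a / 2" .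
  moreover have "0 < \<epsilon>" "\<epsilon> \<le> a / 32"
    unfolding \<epsilon>_def using p \<open>0 < a\<close> by (simp, intro min.cobounded2)
  ultimately have \<epsilon>: "0 < \<epsilon>" "(p + 1) * \<epsilon> \<le> a / 2" "\<epsilon> \<le> a / 32" by auto
  obtain Ug Uh where Ug: "open Ug" "0 \<in> Ug" "\<And>j. Ck r Ug (\<lambda>x. g x $ j)"
    and Uh: "open Uh" "0 \<in> Uh" "\<And>j. Ck r Uh (\<lambda>x. h x $ j)"
    using g h unfolding germ_Cr_def by metis
  have "\<forall>\<^sub>F x in nhds 0. x \<in> Ug \<inter> Uh \<and> infdist x S ^ r \<le> k * (infdist x S * kappa f x + norm (f x)) \<and>
      norm (g x - f x) \<le> \<epsilon> * infdist x S ^ r \<and> norm (jac g x - jac f x) \<le> \<epsilon> * infdist x S ^ (r - 1) \<and>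
      norm (h x - f x) \<le> \<epsilon> * infdist x S ^ r \<and> norm (jac h x - jac f x) \<le> \<epsilon> * infdist x S ^ (r - 1)"
    using cond germs_flat[OF f g jets(1) S _ \<epsilon>(1)] germs_flat[OF f h jets(2) S _ \<epsilon>(1)] r
      eventually_nhds_in_open[of "Ug \<inter> Uh" 0] Ug Uh
    by (auto simp: eventually_conj_iff)
  then obtain \<rho>' where \<rho>': "0 < \<rho>'" "\<And>x. dist x 0 < \<rho>' \<Longrightarrow> x \<in> Ug \<inter> Uh \<and> infdist x S ^ r \<le> k * (infdist x S * kappa f x + norm (f x)) \<and>
      norm (g x - f x) \<le> \<epsilon> * infdist x S ^ r \<and> norm (jac g x - jac f x) \<le> \<epsilon> * infdist x S ^ (r - 1) \<and>
      norm (h x - f x) \<le> \<epsilon> * infdist x S ^ r \<and> norm (jac h x - jac f x) \<le> \<epsilon> * infdist x S ^ (r - 1)"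
    unfolding eventually_nhds_metric by blast
  define \<rho> where "\<rho> = \<rho>' / 2"
  have "0 < \<rho>" using \<rho>' by (simp add: \<rho>_def)
  define d where "d = (\<lambda>x. infdist x S)"
  have d0: "0 \<le> d x" for x by (simp add: d_def infdist_nonneg)
  have near: "x \<in> Ug" "x \<in> Uh" "d x ^ r \<le> k * (d x * kappa f x + norm (f x))"
      "norm (g x - f x) \<le> \<epsilon> * d x ^ r" "norm (jac g x - jac f x) \<le> \<epsilon> * d x ^ (r - 1)"
      "norm (h x - f x) \<le> \<epsilon> * d x ^ r" "norm (jac h x - jac f x) \<le> \<epsilon> * d x ^ (r - 1)"
    if "x \<in> cball 0 \<rho>" for x
  proof -
    have "dist x 0 < \<rho>'" using that \<rho>'(1) by (simp add: \<rho>_def)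
    from \<rho>'(2)[OF this] show "x \<in> Ug" "x \<in> Uh" "d x ^ r \<le> k * (d x * kappa f x + norm (f x))"
      "norm (g x - f x) \<le> \<epsilon> * d x ^ r" "norm (jac g x - jac f x) \<le> \<epsilon> * d x ^ (r - 1)"
      "norm (h x - f x) \<le> \<epsilon> * d x ^ r" "norm (jac h x - jac f x) \<le> \<epsilon> * d x ^ (r - 1)"
      by (auto simp: d_def)
  qed
  define F where "F = (\<lambda>t x. (1 - t) *\<^sub>R g x + t *\<^sub>R h x)"
  define A where "A = (\<lambda>t x. (1 - t) *\<^sub>R jac g x + t *\<^sub>R jac h x)"
  define v where "v = (\<lambda>x. h x - g x)"
  define N where "N = (\<lambda>t x. regularised_gram (d x) ((norm (F t x))\<^sup>2) (A t x))"
  \<comment> \<open>Where d is positive the solution exists. On S the chosen value is arbitrary, but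
    X multiplies it by d^2 = 0.\<close>
  define w where "w = (\<lambda>t x. SOME w. N t x *v w = v x)"
  define X where "X = (\<lambda>t x. - (d x)\<^sup>2 *\<^sub>R (transpose (A t x) *v w t x))"

  have v_le: "norm (v x) \<le> 2 * \<epsilon> * d x ^ r" if "x \<in> cball 0 \<rho>" for x
  proof -
    have "norm (v x) = norm ((h x - f x) - (g x - f x))" by (simp add: v_def)
    also have "\<dots> \<le> norm (h x - f x) + norm (g x - f x)" by (rule norm_triangle_ineq4)
    finally show ?thesis using near(4,6)[OF that] by simp
  qed
  have lower: "a / 2 * d x ^ r * norm u \<le> d x * norm (transpose (A t x) *v u) + norm (F t x) * norm u"
    if x: "x \<in> cball 0 \<rho>" and t: "t \<in> {0..1}" for t x u
  proof -
    have "norm (F t x - f x) \<le> \<epsilon> * d x ^ r" unfolding F_def by (rule norm_convex_combination_diff_le) (use near[OF x] t in auto)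
    then have 1: "norm (f x) - \<epsilon> * d x ^ r \<le> norm (F t x)"
      using norm_triangle_ineq2[of "f x" "f x - F t x"] by (simp add: norm_minus_commute)
    have "norm (A t x - jac f x) \<le> \<epsilon> * d x ^ (r - 1)" unfolding A_def by (rule norm_convex_combination_diff_le) (use near[OF x] t in auto)
    then have "p * norm (A t x - jac f x) * norm u \<le> p * (\<epsilon> * d x ^ (r - 1)) * norm u"
      using p by (intro mult_right_mono mult_left_mono) auto
    then have "norm (transpose (A t x - jac f x) *v u) \<le> p * (\<epsilon> * d x ^ (r - 1)) * norm u"
      using norm_transpose_mult_le[of "A t x - jac f x" u] unfolding p_def by (rule order_trans[rotated])
    moreover have "transpose (A t x - jac f x) *v u = transpose (A t x) *v u - transpose (jac f x) *v u"
      by (simp add: transpose_mult_eq_sum scaleR_right_diff_distrib sum_subtractf)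
    ultimately have "norm (transpose (jac f x) *v u) - p * (\<epsilon> * d x ^ (r - 1)) * norm u \<le> norm (transpose (A t x) *v u)"
      using norm_triangle_ineq2[of "transpose (jac f x) *v u" "transpose (A t x) *v u"]
      by (simp add: norm_minus_commute)
    moreover have "kappa f x * norm u / p \<le> norm (transpose (jac f x) *v u)"
      using kappa_mult_le[of f x u] p by (simp add: p_def field_simps)
    ultimately have "kappa f x * norm u / p - p * (\<epsilon> * d x ^ (r - 1)) * norm u \<le> norm (transpose (A t x) *v u)"
      by linarith
    then have "d x * (kappa f x * norm u / p - p * (\<epsilon> * d x ^ (r - 1)) * norm u) \<le> d x * norm (transpose (A t x) *v u)"
      using d0 by (rule mult_left_mono)
    \<comment> \<open>The factor d in front of the differential restores the power lost by
      differentiating, so the error p * \<epsilon> * d^r has the same order as the error \<epsilon>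
      * d^r in F. Together they make up (p + 1) * \<epsilon> * d^r.\<close>
    moreover have "d x ^ r = d x * d x ^ (r - 1)" using r by (simp add: power_eq_if)
    then have "d x * (kappa f x * norm u / p - p * (\<epsilon> * d x ^ (r - 1)) * norm u)
        = (d x * kappa f x / p - p * \<epsilon> * d x ^ r) * norm u" by (simp only:) (simp add: algebra_simps)
    ultimately have "(d x * kappa f x / p - p * \<epsilon> * d x ^ r) * norm u \<le> d x * norm (transpose (A t x) *v u)"
      by simp
    moreover have "(norm (f x) - \<epsilon> * d x ^ r) * norm u \<le> norm (F t x) * norm u"
      using 1 by (rule mult_right_mono) simp
    moreover have "a * d x ^ r \<le> d x * kappa f x / p + norm (f x)"
    proof -
      have "d x ^ r / k \<le> d x * kappa f x + norm (f x)" using near(3)[OF x] \<open>0 < k\<close> by (simp add: field_simps)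
      then have "d x ^ r / k / p \<le> (d x * kappa f x + norm (f x)) / p" using p by (intro divide_right_mono) auto
      also have "\<dots> \<le> d x * kappa f x / p + norm (f x)"
        using p divide_left_mono[of 1 p "norm (f x)"] by (simp add: add_divide_distrib)
      finally show ?thesis by (simp add: a_def)
    qed
    then have "(a * d x ^ r - (p + 1) * \<epsilon> * d x ^ r) * norm u
        \<le> (d x * kappa f x / p - p * \<epsilon> * d x ^ r + (norm (f x) - \<epsilon> * d x ^ r)) * norm u"
      by (intro mult_right_mono) (auto simp: algebra_simps)
    moreover have "(a - a / 2) * d x ^ r * norm u \<le> (a - (p + 1) * \<epsilon>) * d x ^ r * norm u"
      using \<epsilon>(2) d0 by (intro mult_right_mono) auto
    ultimately show ?thesis by (simp add: algebra_simps)
  qed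
  have mpos: "0 < a / 2 * d x ^ r" if "0 < d x" for x using that \<open>0 < a\<close> by simp
  have Nw: "N t x *v w t x = v x" if "x \<in> cball 0 \<rho>" "t \<in> {0..1}" "0 < d x" for t x
    unfolding w_def N_def
    by (rule someI_ex, rule regularised_gram_solvable[OF mpos[OF that(3)] lower[OF that(1,2)]])
  have N_ge: "(a / 2 * d x ^ r)\<^sup>2 / 2 * norm u \<le> norm (N t x *v u)" if "x \<in> cball 0 \<rho>" "t \<in> {0..1}" "0 < d x" for t x u
    unfolding N_def by (rule regularised_gram_norm_ge[OF mpos[OF that(3)] lower[OF that(1,2)]])
  have X_le: "norm (X t x) \<le> d x / 4" if x: "x \<in> cball 0 \<rho>" and t: "t \<in> {0..1}" for t x
  proof (cases "d x = 0")
    case False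
    then have dpos: "0 < d x" using d0[of x] by simp
    have "d x * norm (transpose (A t x) *v w t x) \<le> 2 * norm (v x) / (a / 2 * d x ^ r)"
      using regularised_gram_solution_bound[OF mpos[OF dpos] lower[OF x t] Nw[OF x t dpos, unfolded N_def]] .
    also have "\<dots> \<le> 2 * (2 * \<epsilon> * d x ^ r) / (a / 2 * d x ^ r)"
      using v_le[OF x] mpos[OF dpos] by (intro divide_right_mono) auto
    also have "\<dots> = 8 * \<epsilon> / a" using dpos by simp
    also have "\<dots> \<le> 1 / 4" using \<epsilon>(3) \<open>0 < a\<close> by (simp add: field_simps)
    finally have "d x * (d x * norm (transpose (A t x) *v w t x)) \<le> d x * (1 / 4)"
      using d0 by (rule mult_left_mono)
    then show ?thesis by (simp add: X_def power2_eq_square mult.assoc)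
  qed (simp add: X_def)

  have lip: "\<exists>L. L-lipschitz_on ({0..1} \<times> {x\<in>cball 0 \<rho>. e \<le> infdist x S}) (\<lambda>(t, x). X t x)" if e: "0 < e" for e
  proof -
    define K where "K = {0..1::real} \<times> {x\<in>cball 0 \<rho>. e \<le> d x}"
    have K: "z \<in> K \<Longrightarrow> snd z \<in> cball 0 \<rho> \<and> fst z \<in> {0..1} \<and> e \<le> d (snd z)" for z by (auto simp: K_def)
    have "closed {x. e \<le> d x}" unfolding d_def by (intro closed_Collect_le continuous_intros)
    then have "compact (cball 0 \<rho> \<inter> {x. e \<le> d x})" by (intro compact_Int_closed) auto
    then have cK: "compact K" unfolding K_def by (intro compact_Times) (auto simp: Int_def)
    have KU: "K \<subseteq> UNIV \<times> cball 0 \<rho>" by (auto simp: K_def)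
    have sub: "cball 0 \<rho> \<subseteq> Ug" "cball 0 \<rho> \<subseteq> Uh" using near(1,2) by blast+
    have fn: "\<exists>L. L-lipschitz_on (cball 0 \<rho>) q" "\<exists>L. L-lipschitz_on (cball 0 \<rho>) (jac q)"
      if "\<And>j. Ck r V (\<lambda>x. q x $ j)" "open V" "cball 0 \<rho> \<subseteq> V" for q :: "real^'n \<Rightarrow> real^'p" and V
    proof -
      show "\<exists>L. L-lipschitz_on (cball 0 \<rho>) q"
        using Ck_lipschitz[OF that, of "[]"] r by (intro lipschitz_vec) simp
      show "\<exists>L. L-lipschitz_on (cball 0 \<rho>) (jac q)"
        using Ck_lipschitz[OF that, of "[_]"] r by (intro lipschitz_vec) (simp add: jac_nth del: hpd.simps)
    qed
    note g_lip = fn[OF Ug(3) Ug(1) sub(1), THEN lipschitz_compose_snd[OF _ KU]]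
    note h_lip = fn[OF Uh(3) Uh(1) sub(2), THEN lipschitz_compose_snd[OF _ KU]]
    have "1-lipschitz_on K fst" by (rule lipschitz_onI) (auto intro: dist_fst_le)
    then have t_lip: "\<exists>L. L-lipschitz_on K fst" "\<exists>L. L-lipschitz_on K (\<lambda>z. 1 - fst z)"
      using lipschitz_on_diff[OF lipschitz_on_constant] by blast+
    have d_lip: "\<exists>L. L-lipschitz_on K (\<lambda>z. d (snd z))"
    proof (rule lipschitz_compose_snd[OF _ KU])
      have "1-lipschitz_on (cball 0 \<rho>) d"
        unfolding d_def by (rule lipschitz_onI) (simp_all add: dist_real_def infdist_triangle_abs)
      then show "\<exists>L. L-lipschitz_on (cball 0 \<rho>) d" ..
    qed
    note scale = lipschitz_bounded_bilinear[OF bounded_bilinear_scaleR cK]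
    have F_lip: "\<exists>L. L-lipschitz_on K (\<lambda>z. F (fst z) (snd z))"
      unfolding F_def by (intro lipschitz_exists_add scale t_lip g_lip h_lip)
    have A_lip: "\<exists>L. L-lipschitz_on K (\<lambda>z. A (fst z) (snd z))"
      unfolding A_def by (intro lipschitz_exists_add scale t_lip g_lip h_lip)
    have At_lip: "\<exists>L. L-lipschitz_on K (\<lambda>z. transpose (A (fst z) (snd z)))"
      using A_lip by (simp add: lipschitz_vec_iff transpose_def)
    have v_lip: "\<exists>L. L-lipschitz_on K (\<lambda>z. v (snd z))"
      unfolding v_def by (intro lipschitz_exists_diff g_lip h_lip)
    have d2_lip: "\<exists>L. L-lipschitz_on K (\<lambda>z. (d (snd z))\<^sup>2)"
      unfolding power2_eq_square by (intro lipschitz_bounded_bilinear[OF bounded_bilinear_mult cK] d_lip)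
    have const_lip: "\<exists>L. L-lipschitz_on K (\<lambda>z. mat 1 :: real^'p^'p)" using lipschitz_on_constant by blast
    have N_lip: "\<exists>L. L-lipschitz_on K (\<lambda>z. N (fst z) (snd z))"
      unfolding N_def regularised_gram_def power2_norm_eq_inner
      by (intro lipschitz_exists_add scale d2_lip A_lip At_lip F_lip const_lip
          lipschitz_bounded_bilinear[OF bounded_bilinear_matrix_mult cK]
          lipschitz_bounded_bilinear[OF bounded_bilinear_inner cK])
    have "\<exists>L. L-lipschitz_on K (\<lambda>z. w (fst z) (snd z))"
    proof (rule lipschitz_linear_solution[OF cK N_lip v_lip])
      \<comment> \<open>The coercivity constant of N on K, with d replaced by its lower bound
        e.\<close>
      show "0 < (a / 2 * e ^ r)\<^sup>2 / 2" using e \<open>0 < a\<close> by simp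
      fix z assume z: "z \<in> K"
      have dz: "0 < d (snd z)" using K[OF z] e by linarith
      show "N (fst z) (snd z) *v w (fst z) (snd z) = v (snd z)" using K[OF z] dz by (intro Nw) auto
      fix u :: "real^'p"
      have "(a / 2 * e ^ r)\<^sup>2 / 2 * norm u \<le> (a / 2 * d (snd z) ^ r)\<^sup>2 / 2 * norm u"
        using K[OF z] e \<open>0 < a\<close> by (intro mult_right_mono divide_right_mono power_mono mult_left_mono) auto
      also have "\<dots> \<le> norm (N (fst z) (snd z) *v u)" using K[OF z] dz by (intro N_ge) auto
      finally show "(a / 2 * e ^ r)\<^sup>2 / 2 * norm u \<le> norm (N (fst z) (snd z) *v u)" .
    qed
    then have "\<exists>L. L-lipschitz_on K (\<lambda>z. (d (snd z))\<^sup>2 *\<^sub>R (transpose (A (fst z) (snd z)) *v w (fst z) (snd z)))"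
      by (intro scale d2_lip lipschitz_bounded_bilinear[OF bounded_bilinear_matrix_vector_mult cK] At_lip)
    then show ?thesis
      by (simp add: K_def d_def X_def case_prod_beta scaleR_minus_left)
  qed
  have X: "subordinate_field S \<rho> X"
    unfolding subordinate_field_def using S \<open>0 < \<rho>\<close> X_le lip by (simp add: d_def)

  have preserve: "g (\<gamma> 0) = 0 \<longleftrightarrow> h (\<gamma> 1) = 0" if \<gamma>: "integral_curve X \<rho> \<gamma>" for \<gamma>
  proof (cases "d (\<gamma> 0) = 0")
    \<comment> \<open>A trajectory starting on S is stationary, and g = h there.\<close>
    case True
    have "\<gamma> 0 \<in> cball 0 \<rho>" using \<gamma> by (auto simp: integral_curve_def)
    then have "norm (v (\<gamma> 0)) \<le> 0" using v_le[of "\<gamma> 0"] True r by (simp add: zero_power)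
    moreover have "\<gamma> 1 = \<gamma> 0" using integral_curve_dist_le[OF X \<gamma>, of 1 0] True by (simp add: d_def)
    ultimately show ?thesis by (simp add: v_def)
  next
    case False
    define e where "e = 2 / 3 * d (\<gamma> 0)"
    have "0 < e" using False d0[of "\<gamma> 0"] by (simp add: e_def)
    have \<gamma>b: "\<gamma> t \<in> cball 0 \<rho>" "e \<le> d (\<gamma> t)" if "t \<in> {0..1}" for t
      using \<gamma> integral_curve_infdist_ge[OF X \<gamma> that, of 0] that by (auto simp: integral_curve_def e_def d_def)
    define G where "G = (\<lambda>t. F t (\<gamma> t))"
    \<comment> \<open>The largest possible |h - g| on the ball over the smallest coercivity constant
      along this trajectory. It depends on the trajectory through e, which is harmless.\<close>
    define W where "W = 2 * \<epsilon> * \<rho> ^ r / ((a / 2 * e ^ r)\<^sup>2 / 2)"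
    have w_le: "norm (w t (\<gamma> t)) \<le> W" if t: "t \<in> {0..1}" for t
    proof -
      have dpos: "0 < d (\<gamma> t)" using \<gamma>b[OF t] \<open>0 < e\<close> by linarith
      have "(a / 2 * e ^ r)\<^sup>2 / 2 * norm (w t (\<gamma> t)) \<le> (a / 2 * d (\<gamma> t) ^ r)\<^sup>2 / 2 * norm (w t (\<gamma> t))"
        using \<gamma>b[OF t] \<open>0 < e\<close> \<open>0 < a\<close> by (intro mult_right_mono divide_right_mono power_mono mult_left_mono) auto
      also have "\<dots> \<le> norm (N t (\<gamma> t) *v w t (\<gamma> t))" by (rule N_ge[OF \<gamma>b(1)[OF t] t dpos])
      also have "\<dots> = norm (v (\<gamma> t))" by (simp only: Nw[OF \<gamma>b(1)[OF t] t dpos])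
      also have "\<dots> \<le> 2 * \<epsilon> * d (\<gamma> t) ^ r" by (rule v_le[OF \<gamma>b(1)[OF t]])
      also have "\<dots> \<le> 2 * \<epsilon> * \<rho> ^ r"
        using \<gamma>b(1)[OF t] infdist_le_norm[OF S(2), of "\<gamma> t"] \<epsilon>(1) d0
        by (intro mult_left_mono power_mono) (auto simp: d_def)
      finally have "(a / 2 * e ^ r)\<^sup>2 / 2 * norm (w t (\<gamma> t)) \<le> 2 * \<epsilon> * \<rho> ^ r" .
      moreover have "0 < (a / 2 * e ^ r)\<^sup>2 / 2" using \<open>0 < e\<close> \<open>0 < a\<close> by simp
      ultimately show ?thesis unfolding W_def by (subst pos_le_divide_eq) (simp_all only: mult.commute[of "norm _"])
    qed
    have "0 \<le> W" using order_trans[OF norm_ge_zero w_le[of 0]] by simp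
    \<comment> \<open>The time derivative of F contributes v, and moving the point contributes A X =
      - d^2 A A^T w = |F|^2 w - v, since M w = v.\<close>
    have G': "(G has_vector_derivative (norm (G t))\<^sup>2 *\<^sub>R w t (\<gamma> t)) (at t within {0..1})" if t: "t \<in> {0..1}" for t
    proof -
      let ?x = "\<gamma> t"
      have dpos: "0 < d ?x" using \<gamma>b[OF t] \<open>0 < e\<close> by linarith
      have \<gamma>': "(\<gamma> has_vector_derivative X t ?x) (at t within {0..1})" using \<gamma> t by (auto simp: integral_curve_def)
      have chain: "((\<lambda>s. q (\<gamma> s)) has_vector_derivative jac q ?x *v X t ?x) (at t within {0..1})"
        if "\<And>j. Ck r V (\<lambda>x. q x $ j)" "open V" "?x \<in> V" for q :: "real^'n \<Rightarrow> real^'p" and V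
      proof -
        have "(q has_derivative (\<lambda>h. jac q ?x *v h)) (at ?x)" using jac_has_derivative[OF that] r by simp
        from vector_derivative_diff_chain_within[OF \<gamma>' has_derivative_at_withinI[OF this]]
        show ?thesis by (simp add: o_def)
      qed
      have g': "((\<lambda>s. g (\<gamma> s)) has_vector_derivative jac g ?x *v X t ?x) (at t within {0..1})"
        by (rule chain[OF Ug(3) Ug(1) near(1)[OF \<gamma>b(1)[OF t]]])
      have h': "((\<lambda>s. h (\<gamma> s)) has_vector_derivative jac h ?x *v X t ?x) (at t within {0..1})"
        by (rule chain[OF Uh(3) Uh(1) near(2)[OF \<gamma>b(1)[OF t]]])
      have "(G has_vector_derivative ((1 - t) *\<^sub>R (jac g ?x *v X t ?x) + (-1) *\<^sub>R g ?x
          + (t *\<^sub>R (jac h ?x *v X t ?x) + 1 *\<^sub>R h ?x))) (at t within {0..1})"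
        unfolding G_def F_def
        by (intro has_vector_derivative_add has_vector_derivative_scaleR g' h')
          (auto intro!: derivative_eq_intros)
      moreover have "(1 - t) *\<^sub>R (jac g ?x *v X t ?x) + (-1) *\<^sub>R g ?x + (t *\<^sub>R (jac h ?x *v X t ?x) + 1 *\<^sub>R h ?x)
          = (norm (G t))\<^sup>2 *\<^sub>R w t ?x"
      proof -
        have "A t ?x *v X t ?x = - (d ?x)\<^sup>2 *\<^sub>R (A t ?x *v (transpose (A t ?x) *v w t ?x))"
          unfolding X_def by (rule matrix_vector_mult_scaleR)
        moreover have "v ?x = (d ?x)\<^sup>2 *\<^sub>R (A t ?x *v (transpose (A t ?x) *v w t ?x)) + (norm (G t))\<^sup>2 *\<^sub>R w t ?x"
          using Nw[OF \<gamma>b(1)[OF t] t dpos] by (simp add: N_def regularised_gram_mult G_def)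
        ultimately have "A t ?x *v X t ?x + v ?x = (norm (G t))\<^sup>2 *\<^sub>R w t ?x" by simp
        then show ?thesis
          by (simp add: A_def v_def matrix_vector_mult_add_rdistrib scaleR_matrix_vector_assoc[symmetric] algebra_simps)
      qed
      ultimately show ?thesis by simp
    qed
    have "continuous_on {0..1} G"
      unfolding continuous_on_eq_continuous_within using G' has_vector_derivative_continuous by blast
    then have "bounded (G ` {0..1})" by (intro compact_imp_bounded compact_continuous_image) auto
    then obtain B where B: "0 < B" "\<And>t. t \<in> {0..1} \<Longrightarrow> norm (G t) \<le> B" unfolding bounded_pos by auto
    let ?u = "\<lambda>t. G t \<bullet> G t"
    let ?u' = "\<lambda>t. 2 * (G t \<bullet> ((norm (G t))\<^sup>2 *\<^sub>R w t (\<gamma> t)))"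
    \<comment> \<open>The derivative of |G|^2 is 2 |G|^2 (G . w), bounded by 2 B W |G|^2 because G
      and w are bounded along the curve. Since F equals g at time 0 and h at time 1, the two
      directions of the estimate give the two implications.\<close>
    have gron: "?u t \<le> exp (2 * B * W) * ?u s" if "s \<in> {0..1}" "t \<in> {0..1}" for s t
    proof (rule gronwall_two_sided[of ?u ?u'])
      fix x :: real assume x: "x \<in> {0..1}"
      have "(?u has_derivative (\<lambda>h. G x \<bullet> (h *\<^sub>R ((norm (G x))\<^sup>2 *\<^sub>R w x (\<gamma> x)))
          + (h *\<^sub>R ((norm (G x))\<^sup>2 *\<^sub>R w x (\<gamma> x))) \<bullet> G x)) (at x within {0..1})"
        using G'[OF x] unfolding has_vector_derivative_def by (intro has_derivative_inner)
      then show "(?u has_real_derivative ?u' x) (at x within {0..1})"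
        unfolding has_field_derivative_def
        by (rule has_derivative_eq_rhs) (auto simp: fun_eq_iff inner_commute)
      have "\<bar>?u' x\<bar> = 2 * \<bar>G x \<bullet> w x (\<gamma> x)\<bar> * (norm (G x))\<^sup>2" by (simp add: abs_mult)
      also have "\<bar>G x \<bullet> w x (\<gamma> x)\<bar> \<le> B * W"
        using B(1) B(2)[OF x] w_le[OF x] by (intro order_trans[OF Cauchy_Schwarz_ineq2] mult_mono) auto
      finally show "\<bar>?u' x\<bar> \<le> 2 * B * W * ?u x" by (simp add: power2_norm_eq_inner mult_right_mono)
    qed (use that B \<open>0 \<le> W\<close> in auto)
    have "G 0 = 0 \<longleftrightarrow> G 1 = 0" using gron[of 0 1] gron[of 1 0] inner_ge_zero[of "G 0"] inner_ge_zero[of "G 1"]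
      by (metis atLeastAtMost_iff inner_eq_zero_iff mult_zero_right order_antisym order_refl zero_le_one)
    then show ?thesis by (simp add: G_def F_def)
  qed

  obtain U V \<phi> \<psi> where UV: "open U" "open V" "0 \<in> U" "0 \<in> V" "homeomorphism U V \<phi> \<psi>"
    "\<And>x. x \<in> U \<inter> S \<Longrightarrow> \<phi> x = x"
    "\<And>x. x \<in> U \<Longrightarrow> \<exists>\<gamma>. integral_curve X \<rho> \<gamma> \<and> \<gamma> 0 = x \<and> \<gamma> 1 = \<phi> x"
    using subordinate_field_homeomorphism[OF X] by metis
  have "homeomorphism {x\<in>U. g x = 0} {x\<in>V. h x = 0} \<phi> \<psi>"
    by (rule homeomorphism_zero_sets[OF UV(5)]) (use UV(7) preserve in metis)
  then show ?thesis unfolding SV_equiv_def using UV by blast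
qed

theorem theorem5p1:
  fixes S :: "(real^'n) set" and f :: "real^'n \<Rightarrow> real^'p" and r :: nat
  assumes "closed S" and "0 \<in> S" and "r \<ge> 1"
    and "CARD('p) \<le> CARD('n)"
    and "germ_Cr r f"
    and "\<exists>K \<delta>. K > 0 \<and> \<delta> > 0 \<and> (\<forall>x\<in>cball 0 \<delta>.
            infdist x S ^ r \<le> K * (infdist x S * kappa f x + norm (f x)))"
  shows "SV_sufficient r S f"
proof -
  obtain k \<delta> where "0 < k" "0 < \<delta>"
    and cond: "\<And>x. x \<in> cball 0 \<delta> \<Longrightarrow> infdist x S ^ r \<le> k * (infdist x S * kappa f x + norm (f x))"
    using assms(6) by blast
  have ev: "\<forall>\<^sub>F x in nhds 0. infdist x S ^ r \<le> k * (infdist x S * kappa f x + norm (f x))"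
    unfolding eventually_nhds_metric using \<open>0 < \<delta>\<close> cond by (intro exI[of _ \<delta>]) (auto simp: dist_commute)
  show ?thesis
    unfolding SV_sufficient_def
  proof (intro allI impI, elim conjE)
    fix g h :: "real^'n \<Rightarrow> real^'p"
    assume gh: "germ_Cr r g" "germ_Cr r h" "rel_jet_eq r S g f" "rel_jet_eq r S h f"
    show "SV_equiv S g h"
    proof (cases "r = 1")
      case True
      then show ?thesis
        using SV_equiv_of_order_1[OF assms(1,2) _ _ _ _ _ \<open>0 < k\<close>, of f g h] assms(5) gh ev by simp
    next
      case False
      then have "2 \<le> r" using assms(3) by simp
      then show ?thesis
        by (rule SV_equiv_of_order_ge_2[OF assms(1,2) _ assms(5) gh \<open>0 < k\<close> ev])
    qed
  qed
qed

end
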